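(* Let $G$ be a second countable ample groupoid with Hausdorff unit space, and let $A(G)$ be its complex Steinberg algebra. Suppose $\pi:A(G) \to B(\mathscr{H})$ is a $*$-homomorphism for some Hilbert space $\mathscr{H}$. Then $\pi$ is bounded with respect to the $I$-norm on $A(G)$.
   Context: A topological groupoid $G$ (with unit space $G^{(0)}$, source $s$ and range $r$) is étale if $s$ (hence $r$) is a local homeomorphism. An open bisection is an open set $B\subseteq G$ such that $r|_B$ and $s|_B$ are homeomorphisms onto open subsets of $G^{(0)}$. $G$ is ample if it has a basis of compact open bisections; compact means every open cover has a finite subcover. $G$ itself need not be Hausdorff. The complex Steinberg algebra is $A(G)=\operatorname{span}_{\mathbb{C}}\{1_B : B\subseteq G \text{ a compact open bisection}\}$, a space of functions $G\to\mathbb{C}$. It is a $*$-algebra under convolution $f*g(\gamma)=\sum_{\alpha\beta=\gamma}f(\alpha)g(\beta)$ and involution $f^*(\gamma)=\overline{f(\gamma^{-1})}$. The $I$-norm of $f\in A(G)$ is \[ \|f\|_I = \sup_{x \in G^{(0)}} \max\Big\{\sum_{\{\gamma : s(\gamma)=x\}}|f(\gamma)|,\ \sum_{\{\gamma : r(\gamma)=x\}} |f(\gamma)|\Big\}.\] $\pi$ is bounded with respect to the $I$-norm if there is a constant $M\ge 0$ with $\|\pi(f)\|\le M\|f\|_I$ for all $f$, where $\|\pi(f)\|$ is the operator norm. $*$-homomorphisms are not assumed bounded or continuous. *)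

theory Defs
  imports "HOL-Analysis.Analysis"
begin

section \<open>Complex Hilbert spaces\<close>

text \<open>
  The class extends \<^class>\<open>banach\<close>, so that the norm, completeness, and the type of bounded
  operators with its operator norm are those of the library. The inner product is linear in its
  first argument. Positive definiteness is contained in \<open>cinner_self\<close>.
\<close>

class complex_hilbert_space = banach +
  fixes scaleC :: "complex \<Rightarrow> 'a \<Rightarrow> 'a" (infixr "*\<^sub>C" 75)
    and cinner :: "'a \<Rightarrow> 'a \<Rightarrow> complex"
  assumes scaleC_add_right: "c *\<^sub>C (x + y) = c *\<^sub>C x + c *\<^sub>C y"
    and scaleC_add_left: "(b + c) *\<^sub>C x = b *\<^sub>C x + c *\<^sub>C x"
    and scaleC_scaleC: "b *\<^sub>C c *\<^sub>C x = (b * c) *\<^sub>C x"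
    and scaleC_of_real: "complex_of_real t *\<^sub>C x = t *\<^sub>R x"
    and cinner_commute: "cinner x y = cnj (cinner y x)"
    and cinner_add_left: "cinner (x + y) z = cinner x z + cinner y z"
    and cinner_scaleC_left: "cinner (c *\<^sub>C x) y = c * cinner x y"
    and cinner_self: "cinner x x = complex_of_real ((norm x)\<^sup>2)"

text \<open>
  Elements of the type of bounded linear operators are only real-linear; the algebra of bounded
  operators on a complex Hilbert space consists of the complex-linear ones.
\<close>

definition bounded_operators :: "('h::complex_hilbert_space \<Rightarrow>\<^sub>L 'h) set" where
  "bounded_operators = {T. \<forall>c x. blinfun_apply T (c *\<^sub>C x) = c *\<^sub>C blinfun_apply T x}"

definition is_adjoint ::
    "('h::complex_hilbert_space \<Rightarrow>\<^sub>L 'h) \<Rightarrow> ('h \<Rightarrow>\<^sub>L 'h) \<Rightarrow> bool" where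
  "is_adjoint S T \<longleftrightarrow>
     (\<forall>x y. cinner (blinfun_apply T x) y = cinner x (blinfun_apply S y))"


section \<open>Topological groupoids\<close>

text \<open>
  The set of arrows is the underlying set of the topology \<open>gtop\<close>, and units are identified with
  their identity arrows. The product \<open>gmult G a b\<close> is meaningful only if the source of \<open>a\<close> is the
  range of \<open>b\<close>.
\<close>

record 'g groupoid_structure =
  gtop :: "'g topology"
  src :: "'g \<Rightarrow> 'g"
  rng :: "'g \<Rightarrow> 'g"
  gmult :: "'g \<Rightarrow> 'g \<Rightarrow> 'g"
  ginv :: "'g \<Rightarrow> 'g"

definition arrows :: "'g groupoid_structure \<Rightarrow> 'g set" where
  "arrows G = topspace (gtop G)"

definition units :: "'g groupoid_structure \<Rightarrow> 'g set" where
  "units G = src G ` arrows G"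

definition unit_top :: "'g groupoid_structure \<Rightarrow> 'g topology" where
  "unit_top G = subtopology (gtop G) (units G)"

definition composable :: "'g groupoid_structure \<Rightarrow> ('g \<times> 'g) set" where
  "composable G = {(a, b). a \<in> arrows G \<and> b \<in> arrows G \<and> src G a = rng G b}"

locale topological_groupoid =
  fixes G :: "'g groupoid_structure"
  assumes src_arrow: "a \<in> arrows G \<Longrightarrow> src G a \<in> arrows G"
    and rng_arrow: "a \<in> arrows G \<Longrightarrow> rng G a \<in> arrows G"
    and src_src: "a \<in> arrows G \<Longrightarrow> src G (src G a) = src G a"
    and rng_src: "a \<in> arrows G \<Longrightarrow> rng G (src G a) = src G a"
    and src_rng: "a \<in> arrows G \<Longrightarrow> src G (rng G a) = rng G a"
    and rng_rng: "a \<in> arrows G \<Longrightarrow> rng G (rng G a) = rng G a"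
    and mult_arrow: "(a, b) \<in> composable G \<Longrightarrow> gmult G a b \<in> arrows G"
    and src_mult: "(a, b) \<in> composable G \<Longrightarrow> src G (gmult G a b) = src G b"
    and rng_mult: "(a, b) \<in> composable G \<Longrightarrow> rng G (gmult G a b) = rng G a"
    and mult_assoc: "(a, b) \<in> composable G \<Longrightarrow> (b, c) \<in> composable G \<Longrightarrow>
          gmult G (gmult G a b) c = gmult G a (gmult G b c)"
    and mult_src: "a \<in> arrows G \<Longrightarrow> gmult G a (src G a) = a"
    and rng_mult_self: "a \<in> arrows G \<Longrightarrow> gmult G (rng G a) a = a"
    and inv_arrow: "a \<in> arrows G \<Longrightarrow> ginv G a \<in> arrows G"
    and src_inv: "a \<in> arrows G \<Longrightarrow> src G (ginv G a) = rng G a"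
    and rng_inv: "a \<in> arrows G \<Longrightarrow> rng G (ginv G a) = src G a"
    and inv_mult: "a \<in> arrows G \<Longrightarrow> gmult G (ginv G a) a = src G a"
    and mult_inv: "a \<in> arrows G \<Longrightarrow> gmult G a (ginv G a) = rng G a"
    and continuous_mult:
      "continuous_map (subtopology (prod_topology (gtop G) (gtop G)) (composable G)) (gtop G)
         (\<lambda>(a, b). gmult G a b)"
    and continuous_inv: "continuous_map (gtop G) (gtop G) (ginv G)"

definition local_homeomorphism :: "'a topology \<Rightarrow> 'b topology \<Rightarrow> ('a \<Rightarrow> 'b) \<Rightarrow> bool" where
  "local_homeomorphism X Y f \<longleftrightarrow>
     (\<forall>x \<in> topspace X. \<exists>U. openin X U \<and> x \<in> U \<and> openin Y (f ` U) \<and>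
        homeomorphic_map (subtopology X U) (subtopology Y (f ` U)) f)"

locale etale_groupoid = topological_groupoid +
  assumes local_homeomorphism_src: "local_homeomorphism (gtop G) (unit_top G) (src G)"

definition open_bisection :: "'g groupoid_structure \<Rightarrow> 'g set \<Rightarrow> bool" where
  "open_bisection G B \<longleftrightarrow> openin (gtop G) B \<and>
     openin (unit_top G) (rng G ` B) \<and>
     homeomorphic_map (subtopology (gtop G) B) (subtopology (unit_top G) (rng G ` B)) (rng G) \<and>
     openin (unit_top G) (src G ` B) \<and>
     homeomorphic_map (subtopology (gtop G) B) (subtopology (unit_top G) (src G ` B)) (src G)"

definition compact_open_bisections :: "'g groupoid_structure \<Rightarrow> 'g set set" where
  "compact_open_bisections G = {B. open_bisection G B \<and> compactin (gtop G) B}"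

locale ample_groupoid = etale_groupoid +
  assumes compact_open_bisection_base:
    "openin (gtop G) U \<Longrightarrow> a \<in> U \<Longrightarrow> \<exists>B \<in> compact_open_bisections G. a \<in> B \<and> B \<subseteq> U"


section \<open>The complex Steinberg algebra\<close>

text \<open>
  Complex functions on the groupoid are represented by functions on the whole type that vanish
  off the set of arrows.
\<close>

definition steinberg_algebra :: "'g groupoid_structure \<Rightarrow> ('g \<Rightarrow> complex) set" where
  "steinberg_algebra G =
     {f. \<exists>F c. finite F \<and> F \<subseteq> compact_open_bisections G \<and>
           f = (\<lambda>x. \<Sum>B\<in>F. c B * indicator B x)}"

text \<open>
  For members of the Steinberg algebra only finitely many terms of the following sum are nonzero.
\<close>

definition convolution ::
    "'g groupoid_structure \<Rightarrow> ('g \<Rightarrow> complex) \<Rightarrow> ('g \<Rightarrow> complex) \<Rightarrow> 'g \<Rightarrow> complex" where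
  "convolution G f g = (\<lambda>x. \<Sum>\<^sub>\<infinity>(a, b) \<in> {(a, b) \<in> composable G. gmult G a b = x}. f a * g b)"

definition involution :: "'g groupoid_structure \<Rightarrow> ('g \<Rightarrow> complex) \<Rightarrow> 'g \<Rightarrow> complex" where
  "involution G f = (\<lambda>x. if x \<in> arrows G then cnj (f (ginv G x)) else 0)"

text \<open>
  The \<open>I\<close>-norm takes values in the extended nonnegative reals, where all sums and suprema exist
  and the supremum over an empty unit space is \<open>0\<close>.
\<close>

definition I_norm :: "'g groupoid_structure \<Rightarrow> ('g \<Rightarrow> complex) \<Rightarrow> ennreal" where
  "I_norm G f = (SUP x \<in> units G.
     max (\<Sum>\<^sub>\<infinity>a \<in> {a \<in> arrows G. src G a = x}. ennreal (cmod (f a)))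
         (\<Sum>\<^sub>\<infinity>a \<in> {a \<in> arrows G. rng G a = x}. ennreal (cmod (f a))))"

definition steinberg_star_hom ::
    "'g groupoid_structure \<Rightarrow> (('g \<Rightarrow> complex) \<Rightarrow> ('h::complex_hilbert_space \<Rightarrow>\<^sub>L 'h)) \<Rightarrow> bool" where
  "steinberg_star_hom G \<pi> \<longleftrightarrow>
     (\<forall>f \<in> steinberg_algebra G. \<pi> f \<in> bounded_operators) \<and>
     (\<forall>f \<in> steinberg_algebra G. \<forall>g \<in> steinberg_algebra G. \<pi> (\<lambda>x. f x + g x) = \<pi> f + \<pi> g) \<and>
     (\<forall>c. \<forall>f \<in> steinberg_algebra G. \<forall>\<xi>.
        blinfun_apply (\<pi> (\<lambda>x. c * f x)) \<xi> = c *\<^sub>C blinfun_apply (\<pi> f) \<xi>) \<and>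
     (\<forall>f \<in> steinberg_algebra G. \<forall>g \<in> steinberg_algebra G.
        \<pi> (convolution G f g) = \<pi> f o\<^sub>L \<pi> g) \<and>
     (\<forall>f \<in> steinberg_algebra G. is_adjoint (\<pi> (involution G f)) (\<pi> f))"

end

theory Submission
  imports Defs
begin

text \<open>
  The representation is contractive for the \<open>I\<close>-norm; the constant is \<open>1\<close>.

  For a compact open bisection \<open>B\<close> the operator \<open>\<pi>(1\<^sub>B)\<close> is a partial isometry. Writing \<open>P(U)\<close> for
  the projection \<open>\<pi>(1\<^sub>U)\<close> of a compact open set \<open>U\<close> of units, its initial projection is \<open>P(s(B))\<close> and
  its final projection is \<open>P(r(B))\<close>, so that twice the modulus of \<open>\<langle>\<pi>(1\<^sub>B) \<xi>, \<eta>\<rangle>\<close> is at most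
  \<open>\<parallel>P(s(B)) \<xi>\<parallel>\<^sup>2 + \<parallel>P(r(B)) \<eta>\<parallel>\<^sup>2\<close> (\<open>cmod_cinner_rep_bisection_le\<close>). Suppose that \<open>f\<close> is a linear combination
  of indicator functions of disjoint bisections \<open>B\<^sub>i\<close> with coefficients \<open>c\<^sub>i\<close>. Summing over \<open>i\<close>
  bounds the matrix coefficient of \<open>\<pi>(f)\<close> by two integrals, one of the step function
  \<open>\<Sum>\<^sub>i \<bar>c\<^sub>i\<bar> 1\<^bsub>s(B\<^sub>i)\<^esub>\<close> against the finitely additive content
  \<open>U \<mapsto> \<parallel>P(U) \<xi>\<parallel>\<^sup>2\<close>, the other of the analogous function for the ranges. By disjointness the values of
  these step functions are the fibre sums of \<open>\<bar>f\<bar>\<close>, hence at most the \<open>I\<close>-norm of \<open>f\<close>, and the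
  bound follows as in Schur's test.

  If \<open>G\<close> is not Hausdorff, intersections of compact open bisections need not be compact, and \<open>f\<close> has
  in general no such disjoint decomposition. The intersections are open, though, and for fixed \<open>\<xi>\<close> and
  \<open>\<eta>\<close> a compact open subset exhausts each of them up to a remainder whose compact open subsets have
  content at most \<open>\<delta>\<close> (\<open>compact_open_exhaustion\<close>). Cutting the bisections along such subsets expresses \<open>f\<close> by
  pieces that are disjoint up to \<open>\<delta>\<close>, where the number of pieces and the size of the coefficients
  do not depend on \<open>\<delta>\<close> (\<open>insert_bisection\<close>, \<open>almost_disjoint_decomposition\<close>). The step
  functions now exceed the \<open>I\<close>-norm of \<open>f\<close> at most on a compact open set of endpoints of overlapping
  pieces, whose content is a bounded multiple of \<open>\<delta>\<close> (\<open>fibre_sum_content_le\<close>). Letting \<open>\<delta>\<close> tend to \<open>0\<close>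
  gives the bound for every \<open>f\<close> (\<open>cmod_cinner_rep_le\<close>). The approximation by compact open sets takes the
  place of the extension of \<open>\<pi>\<close> to Borel functions.
\<close>


section \<open>Inner products\<close>

lemma scaleC_zero_left: "0 *\<^sub>C (x :: 'h::complex_hilbert_space) = 0"
  using scaleC_of_real[of 0 x] by simp

lemma cinner_add_right:
  "cinner (x :: 'h::complex_hilbert_space) (y + z) = cinner x y + cinner x z"
  by (metis cinner_add_left cinner_commute complex_cnj_add)

lemma cinner_scaleC_right: "cinner (x :: 'h::complex_hilbert_space) (c *\<^sub>C y) = cnj c * cinner x y"
  by (metis cinner_commute cinner_scaleC_left complex_cnj_mult)

lemma cinner_zero_left: "cinner 0 (x :: 'h::complex_hilbert_space) = 0"
  using cinner_scaleC_left[of 0 0 x] by (simp add: scaleC_zero_left)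

text \<open>
  The form of the Cauchy--Schwarz inequality that survives summation over many pairs of vectors.
  Multiplying \<open>y\<close> by a phase makes the inner product real and nonpositive, and then the squared
  norm of the sum of the two vectors is nonnegative.
\<close>

lemma cmod_cinner_le:
  fixes x y :: "'h::complex_hilbert_space"
  shows "2 * cmod (cinner x y) \<le> (norm x)\<^sup>2 + (norm y)\<^sup>2"
proof (cases "cinner x y = 0")
  case False
  define r where "r = cmod (cinner x y)"
  define w where "w = - (cinner x y / r)"
  have r: "r > 0" using False by (simp add: r_def)
  have sq: "cinner x y * cnj (cinner x y) = r * r"
    unfolding r_def by (metis complex_norm_square of_real_mult power2_eq_square)
  have w: "w * cnj w = 1"
  proof -
    have "w * cnj w = (cinner x y * cnj (cinner x y)) / (r * r)" by (simp add: w_def)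
    then show ?thesis using r by (simp add: sq)
  qed
  have 1: "cnj w * cinner x y = - r"
  proof -
    have "cnj w * cinner x y = - (cinner x y * cnj (cinner x y) / r)" by (simp add: w_def)
    then show ?thesis using r by (simp add: sq)
  qed
  have 2: "w * cinner y x = - r"
  proof -
    have "w * cinner y x = cnj (cnj w * cinner x y)"
      by (metis cinner_commute complex_cnj_cnj complex_cnj_mult)
    then show ?thesis using 1 by simp
  qed
  have "complex_of_real ((norm (x + w *\<^sub>C y))\<^sup>2) = cinner (x + w *\<^sub>C y) (x + w *\<^sub>C y)"
    by (simp add: cinner_self)
  also have "\<dots> = cinner x x + cnj w * cinner x y + w * cinner y x + (w * cnj w) * cinner y y"
    by (simp add: cinner_add_left cinner_add_right cinner_scaleC_left cinner_scaleC_right algebra_simps)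
  also have "\<dots> = complex_of_real ((norm x)\<^sup>2 - 2 * r + (norm y)\<^sup>2)"
    unfolding 1 2 w cinner_self by simp
  finally have "(norm (x + w *\<^sub>C y))\<^sup>2 = (norm x)\<^sup>2 - 2 * r + (norm y)\<^sup>2"
    using of_real_eq_iff by blast
  then show ?thesis
    using zero_le_power2[of "norm (x + w *\<^sub>C y)"] by (simp add: r_def)
qed simp


section \<open>Finitely additive contents\<close>

locale finite_content = ring_of_sets \<Omega> M
  for \<Omega> :: "'a set" and M +
  fixes \<mu> :: "'a set \<Rightarrow> real"
  assumes content_nonneg: "A \<in> M \<Longrightarrow> 0 \<le> \<mu> A"
    and content_Un: "A \<in> M \<Longrightarrow> B \<in> M \<Longrightarrow> A \<inter> B = {} \<Longrightarrow> \<mu> (A \<union> B) = \<mu> A + \<mu> B"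
begin

lemma content_empty: "\<mu> {} = 0"
  using content_Un[of "{}" "{}"] by simp

lemma content_split: "A \<in> M \<Longrightarrow> B \<in> M \<Longrightarrow> \<mu> A = \<mu> (A \<inter> B) + \<mu> (A - B)"
  using content_Un[of "A \<inter> B" "A - B"] by (simp add: Int Diff Int_Diff_Un Int_Diff_disjoint)

lemma content_mono: "A \<in> M \<Longrightarrow> B \<in> M \<Longrightarrow> A \<subseteq> B \<Longrightarrow> \<mu> A \<le> \<mu> B"
  using content_split[of B A] content_nonneg[of "B - A"] by (simp add: Diff inf.absorb2)

lemma content_subadditive:
  assumes "finite J" "\<And>j. j \<in> J \<Longrightarrow> A j \<in> M"
  shows "\<mu> (\<Union>j\<in>J. A j) \<le> (\<Sum>j\<in>J. \<mu> (A j))"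
  using assms
proof (induction J)
  case (insert j J)
  have U: "(\<Union>i\<in>J. A i) \<in> M" using insert by auto
  have "\<mu> (A j \<union> (\<Union>i\<in>J. A i)) = \<mu> (A j) + \<mu> ((\<Union>i\<in>J. A i) - A j)"
    using content_Un[of "A j" "(\<Union>i\<in>J. A i) - A j"] insert.prems U by (simp add: Diff)
  also have "\<dots> \<le> \<mu> (A j) + \<mu> (\<Union>i\<in>J. A i)"
    using content_mono[of "(\<Union>i\<in>J. A i) - A j" "\<Union>i\<in>J. A i"] insert.prems U by (simp add: Diff)
  finally show ?case using insert by auto
qed (simp add: content_empty)

text \<open>
  Integration of a pointwise inequality between step functions. The proof removes one set \<open>V\<close>
  of the family at a time: on \<open>X \<inter> V\<close> the bound drops by the coefficient of \<open>V\<close>, on \<open>X - V\<close> it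
  stays, so that no common refinement of the family is needed. Once
  the family is used up, a negative bound can occur only on an empty set.
\<close>

lemma step_function_content_le:
  fixes a :: "'i \<Rightarrow> real"
  assumes "finite I" "\<And>i. i \<in> I \<Longrightarrow> U i \<in> M" "X \<in> M"
    and "\<And>x. x \<in> X \<Longrightarrow> (\<Sum>i\<in>I. a i * indicator (U i) x) \<le> b"
  shows "(\<Sum>i\<in>I. a i * \<mu> (U i \<inter> X)) \<le> b * \<mu> X"
  using assms
proof (induction I arbitrary: X b)
  case empty
  show ?case
  proof (cases "X = {}")
    case False
    then have "0 \<le> b" using empty.prems(3) by fastforce
    then show ?thesis using content_nonneg[OF empty.prems(2)] by simp
  qed (simp add: content_empty)
next
  case (insert j I)
  have j: "U j \<in> M" using insert.prems by simp
  have in1: "(\<Sum>i\<in>I. a i * \<mu> (U i \<inter> (X \<inter> U j))) \<le> (b - a j) * \<mu> (X \<inter> U j)"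
  proof (rule insert.IH)
    fix x assume x: "x \<in> X \<inter> U j"
    have "a j * indicator (U j) x + (\<Sum>i\<in>I. a i * indicator (U i) x) \<le> b"
      using insert.prems(3)[of x] x unfolding sum.insert[OF insert.hyps] by blast
    with x show "(\<Sum>i\<in>I. a i * indicator (U i) x) \<le> b - a j"
      by simp
  qed (use insert.prems j in auto)
  have in2: "(\<Sum>i\<in>I. a i * \<mu> (U i \<inter> (X - U j))) \<le> b * \<mu> (X - U j)"
  proof (rule insert.IH)
    fix x assume x: "x \<in> X - U j"
    have "a j * indicator (U j) x + (\<Sum>i\<in>I. a i * indicator (U i) x) \<le> b"
      using insert.prems(3)[of x] x unfolding sum.insert[OF insert.hyps] by blast
    with x show "(\<Sum>i\<in>I. a i * indicator (U i) x) \<le> b"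
      by simp
  qed (use insert.prems j in auto)
  have "\<mu> (U i \<inter> X) = \<mu> (U i \<inter> (X \<inter> U j)) + \<mu> (U i \<inter> (X - U j))" if "i \<in> I" for i
  proof -
    have "U i \<inter> X \<in> M" using insert.prems that by auto
    then show ?thesis using content_split[of "U i \<inter> X" "U j"] j by (simp add: Int_Diff Int_assoc)
  qed
  then have "(\<Sum>i\<in>I. a i * \<mu> (U i \<inter> X)) =
      (\<Sum>i\<in>I. a i * \<mu> (U i \<inter> (X \<inter> U j))) + (\<Sum>i\<in>I. a i * \<mu> (U i \<inter> (X - U j)))"
    by (simp add: sum.distrib[symmetric] distrib_left)
  moreover have "\<mu> X = \<mu> (X \<inter> U j) + \<mu> (X - U j)"
    using content_split insert.prems(2) j by blast
  ultimately show ?case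
    using in1 in2 insert.hyps by (simp add: algebra_simps Int_commute[of "U j" X])
qed

end


section \<open>Compact open bisections\<close>

locale hausdorff_ample_groupoid = ample_groupoid G for G :: "'g groupoid_structure" +
  assumes Hausdorff_units: "Hausdorff_space (unit_top G)"
begin

lemma unit_simps:
  assumes "u \<in> units G"
  shows "u \<in> arrows G" "src G u = u" "rng G u = u" "ginv G u = u"
proof -
  from assms obtain a where a: "a \<in> arrows G" "u = src G a" by (auto simp: units_def)
  then show u: "u \<in> arrows G" and s: "src G u = u" and r: "rng G u = u"
    using src_arrow src_src rng_src by auto
  have "ginv G u = gmult G (ginv G u) (src G (ginv G u))"
    using mult_src inv_arrow u by simp
  also have "\<dots> = gmult G (ginv G u) u" using src_inv u r by simp
  also have "\<dots> = u" using inv_mult u s by simp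
  finally show "ginv G u = u" .
qed

lemma src_in_units: "a \<in> arrows G \<Longrightarrow> src G a \<in> units G"
  by (simp add: units_def)

lemma rng_in_units: "a \<in> arrows G \<Longrightarrow> rng G a \<in> units G"
  by (metis units_def src_rng rng_arrow imageI)

lemma ginv_ginv:
  assumes "a \<in> arrows G"
  shows "ginv G (ginv G a) = a"
proof -
  let ?b = "ginv G (ginv G a)"
  have b: "?b \<in> arrows G" and i: "ginv G a \<in> arrows G" using assms inv_arrow by auto
  have "?b = gmult G ?b (gmult G (ginv G a) a)"
    using mult_src[OF b] src_inv[OF i] rng_inv[OF assms] inv_mult[OF assms] by simp
  also have "\<dots> = gmult G (gmult G ?b (ginv G a)) a"
    by (rule mult_assoc[symmetric])
       (auto simp: composable_def assms b i src_inv rng_inv)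
  also have "\<dots> = a" using inv_mult[OF i] src_inv[OF assms] rng_mult_self[OF assms] by simp
  finally show ?thesis .
qed

lemma topspace_unit_top: "topspace (unit_top G) = units G"
  unfolding unit_top_def using unit_simps(1) by (auto simp: arrows_def)

text \<open>
  Source and range enter the estimates symmetrically. Statements about an endpoint map cover both.
\<close>

definition endpoint :: "('g \<Rightarrow> 'g) \<Rightarrow> bool" where
  "endpoint t \<longleftrightarrow> t = src G \<or> t = rng G"

lemma endpoint_in_units: "endpoint t \<Longrightarrow> a \<in> arrows G \<Longrightarrow> t a \<in> units G"
  by (auto simp: endpoint_def src_in_units rng_in_units)

lemma bisection_homeomorphic:
  assumes "B \<in> compact_open_bisections G" "endpoint t"
  shows "openin (gtop G) B" "compactin (gtop G) B" "B \<subseteq> arrows G" "openin (unit_top G) (t ` B)"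
    "homeomorphic_map (subtopology (gtop G) B) (subtopology (unit_top G) (t ` B)) t" "inj_on t B"
proof -
  show o: "openin (gtop G) B" and "compactin (gtop G) B" and "openin (unit_top G) (t ` B)"
    and h: "homeomorphic_map (subtopology (gtop G) B) (subtopology (unit_top G) (t ` B)) t"
    using assms by (auto simp: compact_open_bisections_def open_bisection_def endpoint_def)
  show B: "B \<subseteq> arrows G" using openin_subset[OF o] by (simp add: arrows_def)
  show "inj_on t B"
    using homeomorphic_imp_injective_map[OF h] B by (simp add: arrows_def inf.absorb2)
qed

lemma endpoint_continuous:
  assumes t: "endpoint t"
  shows "continuous_map (gtop G) (unit_top G) t"
  unfolding continuous_map_def
proof (intro conjI allI impI)
  show "t \<in> topspace (gtop G) \<rightarrow> topspace (unit_top G)"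
    using endpoint_in_units[OF t] by (auto simp: topspace_unit_top arrows_def)
  fix U assume U: "openin (unit_top G) U"
  show "openin (gtop G) {x \<in> topspace (gtop G). t x \<in> U}"
  proof (subst openin_subopen, intro ballI)
    fix x assume x: "x \<in> {x \<in> topspace (gtop G). t x \<in> U}"
    then obtain B where B: "B \<in> compact_open_bisections G" "x \<in> B"
      using compact_open_bisection_base[of "topspace (gtop G)" x] by auto
    note b = bisection_homeomorphic[OF B(1) t]
    have "continuous_map (subtopology (gtop G) B) (unit_top G) t"
      using homeomorphic_imp_continuous_map[OF b(5)] continuous_map_into_fulltopology by blast
    then have "openin (subtopology (gtop G) B) {y \<in> topspace (subtopology (gtop G) B). t y \<in> U}"
      using U by (simp add: continuous_map_def)
    then have "openin (gtop G) {y \<in> topspace (subtopology (gtop G) B). t y \<in> U}"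
      using openin_trans_full b(1) by blast
    then show "\<exists>T. openin (gtop G) T \<and> x \<in> T \<and> T \<subseteq> {x \<in> topspace (gtop G). t x \<in> U}"
      using x B(2) by (intro exI[of _ "{y \<in> topspace (subtopology (gtop G) B). t y \<in> U}"]) auto
  qed
qed

lemma endpoint_open:
  assumes t: "endpoint t" and W: "openin (gtop G) W"
  shows "openin (unit_top G) (t ` W)"
proof (subst openin_subopen, intro ballI)
  fix y assume "y \<in> t ` W"
  then obtain x where x: "x \<in> W" "y = t x" by auto
  obtain B where B: "B \<in> compact_open_bisections G" "x \<in> B" "B \<subseteq> W"
    using compact_open_bisection_base[OF W x(1)] by auto
  show "\<exists>T. openin (unit_top G) T \<and> y \<in> T \<and> T \<subseteq> t ` W"
    using bisection_homeomorphic(4)[OF B(1) t] B x by (intro exI[of _ "t ` B"]) auto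
qed

text \<open>
  An arrow \<open>a\<close> near a unit \<open>u\<close> has its source near \<open>u\<close> as well; if both lie in one bisection,
  they are equal, because they have the same source. Hence arrows near \<open>u\<close> are units.
\<close>

lemma openin_units: "openin (gtop G) (units G)"
proof (subst openin_subopen, intro ballI)
  fix u assume u: "u \<in> units G"
  obtain B where B: "B \<in> compact_open_bisections G" "u \<in> B"
    using compact_open_bisection_base[of "topspace (gtop G)" u] unit_simps(1)[OF u]
    by (auto simp: arrows_def)
  have e: "endpoint (src G)" by (simp add: endpoint_def)
  note b = bisection_homeomorphic[OF B(1) e]
  define V where "V = B \<inter> {x \<in> topspace (gtop G). src G x \<in> B}"
  have "continuous_map (gtop G) (gtop G) (src G)"
    using endpoint_continuous[OF e] unfolding unit_top_def by (simp add: continuous_map_in_subtopology)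
  then have "openin (gtop G) V" unfolding V_def using b(1) by (simp add: continuous_map_def openin_Int)
  moreover have "V \<subseteq> units G"
  proof
    fix a assume a: "a \<in> V"
    then have "a \<in> arrows G" "a \<in> B" "src G a \<in> B" by (auto simp: V_def arrows_def)
    then have "src G a = a" using b(6) src_src unfolding inj_on_def by blast
    then show "a \<in> units G" using \<open>a \<in> arrows G\<close> by (metis src_in_units)
  qed
  moreover have "u \<in> V" using B u unit_simps by (auto simp: V_def arrows_def)
  ultimately show "\<exists>T. openin (gtop G) T \<and> u \<in> T \<and> T \<subseteq> units G" by blast
qed

lemma openin_unit_top: "openin (unit_top G) U \<longleftrightarrow> openin (gtop G) U \<and> U \<subseteq> units G"
  unfolding unit_top_def by (rule openin_open_subtopology[OF openin_units])

text \<open>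
  Source and range are continuous and open, so a compact open set is a bisection as soon as they
  are injective on it. This makes the notion easy to pass on to subsets.
\<close>

lemma compact_open_bisection_iff:
  "B \<in> compact_open_bisections G \<longleftrightarrow>
     openin (gtop G) B \<and> compactin (gtop G) B \<and> inj_on (src G) B \<and> inj_on (rng G) B"
proof
  assume B: "B \<in> compact_open_bisections G"
  show "openin (gtop G) B \<and> compactin (gtop G) B \<and> inj_on (src G) B \<and> inj_on (rng G) B"
    using bisection_homeomorphic[OF B, of "src G"] bisection_homeomorphic[OF B, of "rng G"]
    by (simp add: endpoint_def)
next
  assume B: "openin (gtop G) B \<and> compactin (gtop G) B \<and> inj_on (src G) B \<and> inj_on (rng G) B"
  then have BT: "B \<subseteq> topspace (gtop G)" using openin_subset by blast
  have h: "homeomorphic_map (subtopology (gtop G) B) (subtopology (unit_top G) (t ` B)) t"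
    if t: "endpoint t" for t
  proof (rule bijective_open_imp_homeomorphic_map)
    show "continuous_map (subtopology (gtop G) B) (subtopology (unit_top G) (t ` B)) t"
      using endpoint_continuous[OF t]
      by (auto simp: continuous_map_in_subtopology continuous_map_from_subtopology)
    show "open_map (subtopology (gtop G) B) (subtopology (unit_top G) (t ` B)) t"
      unfolding open_map_def
    proof (intro allI impI)
      fix U assume "openin (subtopology (gtop G) B) U"
      then have U: "openin (gtop G) U" "U \<subseteq> B" using B openin_open_subtopology by auto
      have "openin (unit_top G) (t ` B)" using endpoint_open t B by blast
      then show "openin (subtopology (unit_top G) (t ` B)) (t ` U)"
        using endpoint_open[OF t U(1)] U(2) by (auto simp: openin_open_subtopology)
    qed
    have "t ` B \<subseteq> units G" using BT endpoint_in_units[OF t] by (auto simp: arrows_def)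
    then show "t ` topspace (subtopology (gtop G) B) = topspace (subtopology (unit_top G) (t ` B))"
      using BT by (simp add: topspace_unit_top inf.absorb2)
    show "inj_on t (topspace (subtopology (gtop G) B))"
      using BT B t by (auto simp: inf.absorb2 endpoint_def)
  qed
  have "endpoint (src G)" "endpoint (rng G)" by (simp_all add: endpoint_def)
  then show "B \<in> compact_open_bisections G"
    using B h endpoint_open
    unfolding compact_open_bisections_def open_bisection_def by blast
qed

lemma bisection_subset:
  assumes "B \<in> compact_open_bisections G" "E \<subseteq> B" "openin (gtop G) E" "compactin (gtop G) E"
  shows "E \<in> compact_open_bisections G"
proof -
  have "inj_on (src G) B" "inj_on (rng G) B"
    using assms(1) unfolding compact_open_bisection_iff by simp_all
  then have "inj_on (src G) E" "inj_on (rng G) E"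
    using assms(2) by (simp_all only: inj_on_subset)
  then show ?thesis using assms unfolding compact_open_bisection_iff by simp
qed

lemma empty_bisection: "{} \<in> compact_open_bisections G"
  unfolding compact_open_bisection_iff by simp

lemma bisection_Union:
  assumes "B \<in> compact_open_bisections G" "finite \<F>" "\<F> \<subseteq> compact_open_bisections G" "\<Union>\<F> \<subseteq> B"
  shows "\<Union>\<F> \<in> compact_open_bisections G"
proof (rule bisection_subset[OF assms(1,4)])
  have F: "openin (gtop G) F" "compactin (gtop G) F" if "F \<in> \<F>" for F
    using assms(3) that unfolding compact_open_bisection_iff subset_iff by simp_all
  show "openin (gtop G) (\<Union>\<F>)" by (rule openin_Union) (rule F(1))
  show "compactin (gtop G) (\<Union>\<F>)" by (rule compactin_Union[OF assms(2)]) (rule F(2))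
qed

lemma bisection_Un:
  "B \<in> compact_open_bisections G \<Longrightarrow> C \<in> compact_open_bisections G \<Longrightarrow> D \<in> compact_open_bisections G
   \<Longrightarrow> C \<union> D \<subseteq> B \<Longrightarrow> C \<union> D \<in> compact_open_bisections G"
  using bisection_Union[of B "{C, D}"] by simp

text \<open>
  A bisection is Hausdorff because it embeds into the unit space. So its compact open subsets are
  closed in it and form a Boolean algebra, although compact sets of arrows need not be closed.
\<close>

lemma bisection_Diff:
  assumes B: "B \<in> compact_open_bisections G" and C: "C \<in> compact_open_bisections G" "C \<subseteq> B"
  shows "B - C \<in> compact_open_bisections G"
proof -
  let ?X = "subtopology (gtop G) B"
  have e: "endpoint (src G)" by (simp add: endpoint_def)
  note b = bisection_homeomorphic[OF B e]
  have top: "topspace ?X = B" using b(3) by (auto simp: arrows_def)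
  have "Hausdorff_space ?X"
    by (rule Hausdorff_space_injective_preimage[OF Hausdorff_units
          continuous_map_from_subtopology[OF endpoint_continuous[OF e]]]) (use b(6) top in simp)
  then have "closedin ?X C"
    by (rule compactin_imp_closedin)
      (use C in \<open>simp add: compactin_subtopology compact_open_bisection_iff\<close>)
  then have o: "openin ?X (B - C)" using openin_diff[OF openin_topspace[of ?X]] top by simp
  moreover have "closedin ?X (B - C)"
  proof -
    have "openin ?X C" using C b(1) by (auto simp: openin_open_subtopology compact_open_bisection_iff)
    then show ?thesis using closedin_diff[OF closedin_topspace[of ?X]] top by simp
  qed
  moreover have "compactin ?X B" using b(2) by (simp add: compactin_subtopology)
  ultimately have "compactin ?X (B - C)"
    using closed_compactin[of ?X B "B - C"] by simp
  then show ?thesis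
    using bisection_subset[OF B, of "B - C"] openin_trans_full[OF o b(1)]
    by (simp add: compactin_subtopology)
qed

definition compact_open_units :: "'g set set" where
  "compact_open_units = {U \<in> compact_open_bisections G. U \<subseteq> units G}"

lemma compact_open_units_iff:
  "U \<in> compact_open_units \<longleftrightarrow> openin (gtop G) U \<and> compactin (gtop G) U \<and> U \<subseteq> units G"
proof -
  have "inj_on (src G) U \<and> inj_on (rng G) U" if "U \<subseteq> units G"
    using that unit_simps by (simp add: inj_on_def subset_iff)
  then show ?thesis by (auto simp: compact_open_units_def compact_open_bisection_iff)
qed

lemma ring_compact_open_units: "ring_of_sets (units G) compact_open_units"
proof (rule ring_of_setsI)
  show "compact_open_units \<subseteq> Pow (units G)" by (auto simp: compact_open_units_def)
  show "{} \<in> compact_open_units" by (simp add: compact_open_units_iff)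
  show Un: "a \<union> b \<in> compact_open_units" if "a \<in> compact_open_units" "b \<in> compact_open_units" for a b
    using that by (auto simp: compact_open_units_iff compactin_Un)
  show "a - b \<in> compact_open_units" if "a \<in> compact_open_units" "b \<in> compact_open_units" for a b
  proof -
    have "a \<union> b - b \<in> compact_open_bisections G"
      using Un[OF that] that by (intro bisection_Diff) (auto simp: compact_open_units_def)
    then show ?thesis using that by (auto simp: compact_open_units_def Un_Diff)
  qed
qed

sublocale unit_ring: ring_of_sets "units G" compact_open_units
  by (rule ring_compact_open_units)

lemma endpoint_image:
  assumes "endpoint t" "B \<in> compact_open_bisections G"
  shows "t ` B \<in> compact_open_units"
proof -
  have B: "openin (gtop G) B" "compactin (gtop G) B"
    using assms(2) by (simp_all add: compact_open_bisection_iff)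
  have "compactin (unit_top G) (t ` B)"
    by (rule image_compactin[OF B(2) endpoint_continuous[OF assms(1)]])
  then have "compactin (gtop G) (t ` B)" by (simp add: unit_top_def compactin_subtopology)
  then show ?thesis
    using endpoint_open[OF assms(1) B(1)] by (simp add: compact_open_units_iff openin_unit_top)
qed

lemma bisection_inj_on: "B \<in> compact_open_bisections G \<Longrightarrow> endpoint t \<Longrightarrow> inj_on t B"
  using bisection_homeomorphic(6) .

end


section \<open>Decomposition into almost disjoint bisections\<close>

context hausdorff_ample_groupoid
begin

text \<open>
  Unions of bisections need not be bisections, so the compact open bisections do not form a ring of
  sets. Additivity is asked for only where the union is again a bisection.
\<close>

definition bisection_content :: "('g set \<Rightarrow> real) \<Rightarrow> bool" where
  "bisection_content \<nu> \<longleftrightarrow>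
     (\<forall>E \<in> compact_open_bisections G. 0 \<le> \<nu> E) \<and>
     (\<forall>E \<in> compact_open_bisections G. \<forall>F \<in> compact_open_bisections G.
        E \<union> F \<in> compact_open_bisections G \<longrightarrow> E \<inter> F = {} \<longrightarrow> \<nu> (E \<union> F) = \<nu> E + \<nu> F)"

lemma bisection_content_mono:
  assumes "bisection_content \<nu>" "E \<in> compact_open_bisections G" "B \<in> compact_open_bisections G" "E \<subseteq> B"
  shows "\<nu> E \<le> \<nu> B"
proof -
  have D: "B - E \<in> compact_open_bisections G" using assms bisection_Diff by blast
  have eq: "E \<union> (B - E) = B" using assms(4) by blast
  have "\<nu> (E \<union> (B - E)) = \<nu> E + \<nu> (B - E)"
    using assms(1,2,3) D eq unfolding bisection_content_def by (metis Diff_disjoint)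
  moreover have "0 \<le> \<nu> (B - E)" using assms(1) D unfolding bisection_content_def by blast
  ultimately show ?thesis unfolding eq by simp
qed

text \<open>
  The intersection of two bisections is open but need not be compact, so it carries no indicator
  function in the algebra. It is exhausted by a compact open set up to a remainder that is
  small for the content: a compact open set disjoint from a nearly maximal one could be added to it.
\<close>

lemma compact_open_exhaustion:
  assumes nu: "bisection_content \<nu>" and B: "B \<in> compact_open_bisections G" and W: "W \<subseteq> B"
    and "\<delta> > 0"
  shows "\<exists>C \<in> compact_open_bisections G. C \<subseteq> W \<and>
           (\<forall>E \<in> compact_open_bisections G. E \<subseteq> W - C \<longrightarrow> \<nu> E \<le> \<delta>)"
proof -
  define S where "S = \<nu> ` {E \<in> compact_open_bisections G. E \<subseteq> W}"
  have "\<nu> {} \<in> S" using empty_bisection by (auto simp: S_def)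
  have bdd: "bdd_above S"
    unfolding S_def bdd_above_def using bisection_content_mono[OF nu _ B] W by blast
  have "Sup S - \<delta> < Sup S" using \<open>\<delta> > 0\<close> by simp
  then obtain C where C: "C \<in> compact_open_bisections G" "C \<subseteq> W" "Sup S - \<delta> < \<nu> C"
    using less_cSup_iff[of S] \<open>\<nu> {} \<in> S\<close> bdd unfolding S_def by blast
  have "\<nu> E \<le> \<delta>" if E: "E \<in> compact_open_bisections G" "E \<subseteq> W - C" for E
  proof -
    have EC: "E \<union> C \<in> compact_open_bisections G"
      using bisection_Un[OF B E(1) C(1)] E(2) C(2) W by blast
    moreover have "E \<inter> C = {}" using E(2) by blast
    ultimately have "\<nu> (E \<union> C) = \<nu> E + \<nu> C"
      using nu E(1) C(1) unfolding bisection_content_def by blast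
    moreover have "\<nu> (E \<union> C) \<le> Sup S"
      using EC E(2) C(2) by (intro cSup_upper bdd) (auto simp: S_def)
    ultimately show ?thesis using C(3) by simp
  qed
  then show ?thesis using C by blast
qed

definition almost_disjoint :: "('g set \<Rightarrow> real) \<Rightarrow> real \<Rightarrow> 'g set \<Rightarrow> 'g set \<Rightarrow> bool" where
  "almost_disjoint \<nu> \<delta> D D' \<longleftrightarrow> (\<forall>E \<in> compact_open_bisections G. E \<subseteq> D \<inter> D' \<longrightarrow> \<nu> E \<le> \<delta>)"

lemma almost_disjoint_subset:
  "almost_disjoint \<nu> \<delta> D D' \<Longrightarrow> C \<subseteq> D \<Longrightarrow> C' \<subseteq> D' \<Longrightarrow> almost_disjoint \<nu> \<delta> C C'"
  unfolding almost_disjoint_def by blast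

definition step_function :: "(complex \<times> 'g set) list \<Rightarrow> 'g \<Rightarrow> complex" where
  "step_function L x = (\<Sum>(d, D) \<leftarrow> L. d * indicator D x)"

lemma step_function_simps [simp]:
  "step_function [] x = 0"
  "step_function ((d, D) # L) x = d * indicator D x + step_function L x"
  by (simp_all add: step_function_def)

definition almost_disjoint_pieces ::
    "('g set \<Rightarrow> real) \<Rightarrow> real \<Rightarrow> real \<Rightarrow> (complex \<times> 'g set) list \<Rightarrow> bool" where
  "almost_disjoint_pieces \<nu> \<delta> K L \<longleftrightarrow>
     (\<forall>p \<in> set L. snd p \<in> compact_open_bisections G \<and> cmod (fst p) \<le> K) \<and>
     sorted_wrt (\<lambda>p q. almost_disjoint \<nu> \<delta> (snd p) (snd q)) L"

text \<open>
  Let \<open>C\<close> nearly exhaust \<open>D \<inter> B\<close>. Then \<open>D\<close> is cut into \<open>D - C\<close> and \<open>C\<close>, and only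
  \<open>B - C\<close> is passed on to the other pieces; it is disjoint from \<open>C\<close> and almost disjoint from
  \<open>D - C\<close>. The last clause of the conclusion keeps the pieces produced by the recursive call almost
  disjoint from \<open>D - C\<close> and \<open>C\<close>. Neither the number of pieces nor the bound on the coefficients
  depends on \<open>\<delta>\<close>.
\<close>

lemma insert_bisection:
  assumes nu: "bisection_content \<nu>" and "\<delta> > 0" and "0 \<le> K"
  shows "B \<in> compact_open_bisections G \<Longrightarrow> almost_disjoint_pieces \<nu> \<delta> K L \<Longrightarrow>
    \<exists>R. almost_disjoint_pieces \<nu> \<delta> (K + cmod c) R \<and> length R \<le> 2 * length L + 1 \<and>
        (\<forall>x. step_function R x = step_function L x + c * indicator B x) \<and>
        (\<forall>p \<in> set R. snd p \<subseteq> B \<or> (\<exists>q \<in> set L. snd p \<subseteq> snd q))"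
proof (induction L arbitrary: B)
  case Nil
  then show ?case
    using \<open>0 \<le> K\<close> by (intro exI[of _ "[(c, B)]"]) (simp add: almost_disjoint_pieces_def)
next
  case (Cons q L)
  obtain d D where q: "q = (d, D)" by (cases q)
  have D: "D \<in> compact_open_bisections G" "cmod d \<le> K"
    and LD: "\<And>p. p \<in> set L \<Longrightarrow> almost_disjoint \<nu> \<delta> D (snd p)"
    and L: "almost_disjoint_pieces \<nu> \<delta> K L"
    using Cons.prems(2) by (auto simp: q almost_disjoint_pieces_def)
  have "\<exists>C \<in> compact_open_bisections G. C \<subseteq> D \<inter> B \<and>
      (\<forall>E \<in> compact_open_bisections G. E \<subseteq> D \<inter> B - C \<longrightarrow> \<nu> E \<le> \<delta>)"
    by (rule compact_open_exhaustion[OF nu Cons.prems(1) _ \<open>\<delta> > 0\<close>]) simp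
  then obtain C where C: "C \<in> compact_open_bisections G" "C \<subseteq> D" "C \<subseteq> B"
    and small: "\<And>E. E \<in> compact_open_bisections G \<Longrightarrow> E \<subseteq> D \<inter> B - C \<Longrightarrow> \<nu> E \<le> \<delta>"
    by auto
  have DC: "D - C \<in> compact_open_bisections G" and BC: "B - C \<in> compact_open_bisections G"
    using bisection_Diff[OF D(1) C(1,2)] bisection_Diff[OF Cons.prems(1) C(1,3)] .
  from Cons.IH[OF BC L] obtain R where R: "almost_disjoint_pieces \<nu> \<delta> (K + cmod c) R"
      "length R \<le> 2 * length L + 1"
      "\<And>x. step_function R x = step_function L x + c * indicator (B - C) x"
      "\<And>p. p \<in> set R \<Longrightarrow> snd p \<subseteq> B - C \<or> (\<exists>q \<in> set L. snd p \<subseteq> snd q)"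
    by blast
  have empty_small: "\<nu> {} \<le> \<delta>" using small[OF empty_bisection] by simp
  have rest: "almost_disjoint \<nu> \<delta> (D - C) (snd p) \<and> almost_disjoint \<nu> \<delta> C (snd p)"
    if "p \<in> set R" for p
    using R(4)[OF that]
  proof
    assume p: "snd p \<subseteq> B - C"
    have "almost_disjoint \<nu> \<delta> (D - C) (snd p)"
      unfolding almost_disjoint_def
    proof (intro ballI impI)
      fix E assume "E \<in> compact_open_bisections G" "E \<subseteq> (D - C) \<inter> snd p"
      then show "\<nu> E \<le> \<delta>" using p by (intro small) blast+
    qed
    moreover have "C \<inter> snd p = {}" using p by blast
    ultimately show ?thesis using empty_small by (simp add: almost_disjoint_def)
  next
    assume "\<exists>q \<in> set L. snd p \<subseteq> snd q"
    then obtain q' where "q' \<in> set L" "snd p \<subseteq> snd q'" by blast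
    then show ?thesis
      using almost_disjoint_subset[OF LD] C(2) Diff_subset by metis
  qed
  have "(D - C) \<inter> C = {}" by blast
  then have DC_C: "almost_disjoint \<nu> \<delta> (D - C) C"
    using empty_small by (simp add: almost_disjoint_def)
  have norms: "cmod d \<le> K + cmod c" "cmod (d + c) \<le> K + cmod c"
    using D(2) norm_triangle_ineq[of d c] norm_ge_zero[of c] by linarith+
  have sum: "step_function ((d, D - C) # (d + c, C) # R) x =
      step_function (q # L) x + c * indicator B x" for x
    using C(2,3) by (auto simp: R(3) q indicator_def algebra_simps)
  have nested: "snd p \<subseteq> B \<or> (\<exists>q' \<in> set (q # L). snd p \<subseteq> snd q')"
    if "p \<in> set ((d, D - C) # (d + c, C) # R)" for p
  proof -
    have "snd p \<subseteq> snd q \<or> p \<in> set R" using that C(2) by (auto simp: q)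
    then show ?thesis using R(4)[of p] by auto
  qed
  have "almost_disjoint_pieces \<nu> \<delta> (K + cmod c) ((d, D - C) # (d + c, C) # R)"
    using R(1) DC C(1) norms DC_C rest by (simp add: almost_disjoint_pieces_def)
  then show ?case
    using sum nested R(2) by (intro exI[of _ "(d, D - C) # (d + c, C) # R"]) simp
qed

text \<open>
  The order of quantifiers is the point: \<open>N\<close> and \<open>K\<close> are fixed before \<open>\<delta>\<close>, so a bound of the
  form \<open>\<delta>\<close> times an expression in \<open>N\<close> and \<open>K\<close> tends to \<open>0\<close> with \<open>\<delta>\<close>.
\<close>

lemma almost_disjoint_decomposition:
  assumes nu: "bisection_content \<nu>" and f: "f \<in> steinberg_algebra G"
  shows "\<exists>N K. 0 \<le> K \<and>
    (\<forall>\<delta>>0. \<exists>L. almost_disjoint_pieces \<nu> \<delta> K L \<and> length L \<le> N \<and> f = step_function L)"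
proof -
  obtain F c where F: "finite F" "F \<subseteq> compact_open_bisections G"
    and f_eq: "f = (\<lambda>x. \<Sum>B\<in>F. c B * indicator B x)"
    using f by (auto simp: steinberg_algebra_def)
  have "\<exists>N K. 0 \<le> K \<and> (\<forall>\<delta>>0. \<exists>L. almost_disjoint_pieces \<nu> \<delta> K L \<and> length L \<le> N \<and>
      (\<lambda>x. \<Sum>B\<in>F. c B * indicator B x) = step_function L)"
    using F
  proof (induction F)
    case empty
    show ?case
      by (intro exI[of _ 0] exI[of _ "0::real"] conjI allI impI exI[of _ "[]"])
         (auto simp: almost_disjoint_pieces_def)
  next
    case (insert B F)
    then obtain N K where K: "0 \<le> K"
      and L: "\<And>\<delta>. \<delta> > 0 \<Longrightarrow> \<exists>L. almost_disjoint_pieces \<nu> \<delta> K L \<and> length L \<le> N \<and>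
        (\<lambda>x. \<Sum>B\<in>F. c B * indicator B x) = step_function L" by auto
    have "\<exists>R. almost_disjoint_pieces \<nu> \<delta> (K + cmod (c B)) R \<and> length R \<le> 2 * N + 1 \<and>
        (\<lambda>x. \<Sum>B\<in>insert B F. c B * indicator B x) = step_function R" if \<delta>: "\<delta> > 0" for \<delta>
    proof -
      obtain L where L: "almost_disjoint_pieces \<nu> \<delta> K L" "length L \<le> N"
        "(\<lambda>x. \<Sum>B\<in>F. c B * indicator B x) = step_function L" using L[OF \<delta>] by blast
      have "B \<in> compact_open_bisections G" using insert.prems by simp
      from insert_bisection[OF nu \<delta> K this L(1), of "c B"] obtain R where
        "almost_disjoint_pieces \<nu> \<delta> (K + cmod (c B)) R" "length R \<le> 2 * length L + 1"
        and R: "\<And>x. step_function R x = step_function L x + c B * indicator B x" by blast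
      moreover have "(\<lambda>x. \<Sum>B\<in>insert B F. c B * indicator B x) = step_function R"
        using fun_cong[OF L(3)] unfolding sum.insert[OF insert.hyps] by (simp add: R fun_eq_iff)
      ultimately show ?thesis using L(2) by (intro exI[of _ R]) auto
    qed
    then show ?case using K by (intro exI[of _ "2 * N + 1"] exI[of _ "K + cmod (c B)"]) auto
  qed
  then show ?thesis unfolding f_eq .
qed


section \<open>Integrating fibre sums\<close>

text \<open>
  If \<open>x\<close> is not the endpoint of an arrow common to two of the bisections, then each bisection that
  meets the fibre over \<open>x\<close> has its own arrow there, and at that arrow the function equals the
  coefficient of that bisection alone. Elsewhere cancellation could make the fibre sum smaller.
\<close>

lemma coefficient_sum_le_fibre_sum:
  fixes d :: "'i \<Rightarrow> complex"
  assumes t: "endpoint t" and I: "finite I" and D: "\<And>i. i \<in> I \<Longrightarrow> D i \<in> compact_open_bisections G"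
    and bound: "\<And>\<Gamma>. finite \<Gamma> \<Longrightarrow> \<Gamma> \<subseteq> {a \<in> arrows G. t a = x} \<Longrightarrow>
        (\<Sum>a\<in>\<Gamma>. cmod (\<Sum>i\<in>I. d i * indicator (D i) a)) \<le> c"
    and x: "\<And>i j. i \<in> I \<Longrightarrow> j \<in> I \<Longrightarrow> i \<noteq> j \<Longrightarrow> x \<notin> t ` (D i \<inter> D j)"
  shows "(\<Sum>i\<in>I. cmod (d i) * indicator (t ` D i) x) \<le> c"
proof -
  define J where "J = {i \<in> I. x \<in> t ` D i}"
  define g where "g i = inv_into (D i) t x" for i
  have g: "g i \<in> D i" "t (g i) = x" if "i \<in> J" for i
    using that unfolding J_def g_def by (simp_all add: inv_into_into f_inv_into_f)
  have only: "j = i" if "i \<in> J" "j \<in> I" "g i \<in> D j" for i j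
  proof (rule ccontr)
    assume "j \<noteq> i"
    moreover have "i \<in> I" using that(1) by (simp add: J_def)
    moreover have "x \<in> t ` (D i \<inter> D j)"
      by (rule image_eqI[of _ _ "g i"]) (use g[OF that(1)] that(3) in simp_all)
    ultimately show False using x[of i j] that(2) by simp
  qed
  have inj: "inj_on g J"
  proof (rule inj_onI)
    fix i j assume "i \<in> J" "j \<in> J" "g i = g j"
    then show "i = j" using only[of j i] g(1)[of i] by (simp add: J_def)
  qed
  have val: "(\<Sum>k\<in>I. d k * indicator (D k) (g i)) = d i" if i: "i \<in> J" for i
  proof -
    have "(\<Sum>k\<in>I. d k * indicator (D k) (g i)) = (\<Sum>k\<in>I. if k = i then d k else 0)"
      by (rule sum.cong) (use only[OF i] g[OF i] in \<open>auto simp: indicator_def\<close>)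
    then show ?thesis using i I by (simp add: J_def)
  qed
  have "(\<Sum>i\<in>I. cmod (d i) * indicator (t ` D i) x) = (\<Sum>i\<in>J. cmod (d i))"
    unfolding J_def using I by (intro sum.mono_neutral_cong_right) (auto simp: indicator_def)
  also have "\<dots> = (\<Sum>a\<in>g ` J. cmod (\<Sum>k\<in>I. d k * indicator (D k) a))"
    using val by (simp add: sum.reindex[OF inj])
  also have "\<dots> \<le> c"
  proof (rule bound)
    show "finite (g ` J)" using I by (simp add: J_def)
    show "g ` J \<subseteq> {a \<in> arrows G. t a = x}"
    proof (intro subsetI CollectI)
      fix a assume "a \<in> g ` J"
      then obtain i where i: "i \<in> J" "a = g i" by blast
      then have "D i \<subseteq> arrows G" using bisection_homeomorphic(3)[OF D t] by (simp add: J_def)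
      then show "a \<in> arrows G \<and> t a = x" using g[OF i(1)] i(2) by blast
    qed
  qed
  finally show ?thesis .
qed

text \<open>
  Compactness gives finitely many small bisections, in a number beyond control. Those inside the
  same \<open>W p\<close> have a union that is again a bisection because it lies in \<open>B p\<close>, so one set for each
  \<open>p\<close> suffices.
\<close>

lemma compact_cover_by_bisections:
  assumes t: "endpoint t" and E: "E \<in> compact_open_units" and P: "finite P"
    and W: "\<And>p. p \<in> P \<Longrightarrow> openin (gtop G) (W p)"
    and B: "\<And>p. p \<in> P \<Longrightarrow> B p \<in> compact_open_bisections G \<and> W p \<subseteq> B p"
    and cover: "E \<subseteq> (\<Union>p\<in>P. t ` W p)"
  shows "\<exists>C. (\<forall>p\<in>P. C p \<in> compact_open_bisections G \<and> C p \<subseteq> W p) \<and> E \<subseteq> (\<Union>p\<in>P. t ` C p)"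
proof -
  define \<S> where "\<S> = {F \<in> compact_open_bisections G. \<exists>p\<in>P. F \<subseteq> W p}"
  have "\<exists>\<F>. finite \<F> \<and> \<F> \<subseteq> (`) t ` \<S> \<and> E \<subseteq> \<Union>\<F>"
  proof (rule compactinD)
    show "compactin (gtop G) E" using E compact_open_units_iff by blast
    show "openin (gtop G) U" if "U \<in> (`) t ` \<S>" for U
      using that endpoint_image[OF t] unfolding \<S>_def compact_open_units_iff by blast
    show "E \<subseteq> \<Union>((`) t ` \<S>)"
    proof
      fix x assume "x \<in> E"
      then obtain p a where p: "p \<in> P" "a \<in> W p" "x = t a" using cover by blast
      obtain F where "F \<in> compact_open_bisections G" "a \<in> F" "F \<subseteq> W p"
        using compact_open_bisection_base[OF W[OF p(1)] p(2)] by blast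
      then show "x \<in> \<Union>((`) t ` \<S>)" unfolding \<S>_def using p by blast
    qed
  qed
  then obtain \<G> where G: "finite \<G>" "\<G> \<subseteq> \<S>" "E \<subseteq> \<Union>((`) t ` \<G>)"
    by (metis finite_subset_image)
  define C where "C p = \<Union>{F \<in> \<G>. F \<subseteq> W p}" for p
  have "C p \<in> compact_open_bisections G \<and> C p \<subseteq> W p" if p: "p \<in> P" for p
  proof
    show "C p \<subseteq> W p" by (auto simp: C_def)
    show "C p \<in> compact_open_bisections G"
      unfolding C_def
    proof (rule bisection_Union)
      show "B p \<in> compact_open_bisections G" using B p by blast
      show "\<Union>{F \<in> \<G>. F \<subseteq> W p} \<subseteq> B p" using B[OF p] by blast
      show "{F \<in> \<G>. F \<subseteq> W p} \<subseteq> compact_open_bisections G" using G(2) by (auto simp: \<S>_def)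
    qed (use G(1) in simp)
  qed
  moreover have "E \<subseteq> (\<Union>p\<in>P. t ` C p)"
  proof
    fix x assume "x \<in> E"
    then obtain F where F: "F \<in> \<G>" "x \<in> t ` F" using G(3) by blast
    then obtain p where "p \<in> P" "F \<subseteq> W p" using G(2) unfolding \<S>_def by blast
    then show "x \<in> (\<Union>p\<in>P. t ` C p)" using F unfolding C_def by blast
  qed
  ultimately show ?thesis by blast
qed

text \<open>
  The left-hand side integrates a step function that is at most \<open>c\<close> except on a compact open set
  \<open>E\<close>, every point of which is the endpoint of an arrow common to two of the bisections. By
  compactness \<open>E\<close> is covered by the endpoints of one compact open bisection for each pair of
  indices, contained in the intersection for that pair. So the content of \<open>E\<close> is at most \<open>\<delta>\<close>
  times the number of pairs.
\<close>

lemma fibre_sum_content_le: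
  fixes d :: "'i \<Rightarrow> complex"
  assumes mu: "finite_content (units G) compact_open_units \<mu>"
    and t: "endpoint t" and I: "finite I" and D: "\<And>i. i \<in> I \<Longrightarrow> D i \<in> compact_open_bisections G"
    and bound: "\<And>x \<Gamma>. x \<in> units G \<Longrightarrow> finite \<Gamma> \<Longrightarrow> \<Gamma> \<subseteq> {a \<in> arrows G. t a = x} \<Longrightarrow>
        (\<Sum>a\<in>\<Gamma>. cmod (\<Sum>i\<in>I. d i * indicator (D i) a)) \<le> c"
    and small: "\<And>i j E. i \<in> I \<Longrightarrow> j \<in> I \<Longrightarrow> i \<noteq> j \<Longrightarrow> E \<in> compact_open_bisections G \<Longrightarrow>
        E \<subseteq> D i \<inter> D j \<Longrightarrow> \<mu> (t ` E) \<le> \<delta>"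
    and "0 \<le> c" "0 \<le> \<delta>"
  shows "(\<Sum>i\<in>I. cmod (d i) * \<mu> (t ` D i)) \<le>
    c * \<mu> (\<Union>i\<in>I. t ` D i) + (\<Sum>i\<in>I. cmod (d i)) * ((real (card I))\<^sup>2 * \<delta>)"
proof -
  interpret mu: finite_content "units G" compact_open_units \<mu> by (rule mu)
  define U where "U i = t ` D i" for i
  define X where "X = (\<Union>i\<in>I. U i)"
  \<comment> \<open>\<open>E\<close> is the set where the step function exceeds \<open>c\<close>, written so that it visibly belongs to the
    ring: every index set in \<open>\<S>\<close> is nonempty because \<open>c\<close> is nonnegative\<close>
  define \<S> where "\<S> = {S. S \<subseteq> I \<and> c < (\<Sum>i\<in>S. cmod (d i))}"
  define E where "E = (\<Union>S\<in>\<S>. \<Inter>i\<in>S. U i)"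
  define P where "P = {p \<in> I \<times> I. fst p \<noteq> snd p}"
  have U: "U i \<in> compact_open_units" if "i \<in> I" for i
    using endpoint_image[OF t D[OF that]] by (simp add: U_def)
  have X: "X \<in> compact_open_units" unfolding X_def using U I by blast
  have fin: "finite \<S>" unfolding \<S>_def using I by simp
  have S: "S \<noteq> {}" "finite S" "S \<subseteq> I" if "S \<in> \<S>" for S
    using that \<open>0 \<le> c\<close> finite_subset[OF _ I] unfolding \<S>_def by auto
  have E: "E \<in> compact_open_units"
    unfolding E_def
  proof (rule unit_ring.finite_UN[OF fin])
    fix S assume "S \<in> \<S>"
    note S = S[OF this]
    show "(\<Inter>i\<in>S. U i) \<in> compact_open_units"
      by (rule unit_ring.finite_INT[OF S(2,1)]) (use S(3) U in blast)
  qed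
  have above: "c < (\<Sum>i\<in>I. cmod (d i) * indicator (U i) x)" if "x \<in> E" for x
  proof -
    obtain S where S: "S \<subseteq> I" "c < (\<Sum>i\<in>S. cmod (d i))" "\<And>i. i \<in> S \<Longrightarrow> x \<in> U i"
      using \<open>x \<in> E\<close> unfolding E_def \<S>_def by blast
    have "(\<Sum>i\<in>S. cmod (d i)) = (\<Sum>i\<in>S. cmod (d i) * indicator (U i) x)"
      using S(3) by (intro sum.cong) auto
    also have "\<dots> \<le> (\<Sum>i\<in>I. cmod (d i) * indicator (U i) x)"
      using S(1) I by (intro sum_mono2) (auto simp: indicator_def)
    finally show ?thesis using S(2) by simp
  qed
  have below: "(\<Sum>i\<in>I. cmod (d i) * indicator (U i) x) \<le> c" if "x \<notin> E" for x
  proof -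
    have "(\<Sum>i\<in>I. cmod (d i) * indicator (U i) x) = (\<Sum>i\<in>{i \<in> I. x \<in> U i}. cmod (d i))"
      using I by (intro sum.mono_neutral_cong_right) (auto simp: indicator_def)
    moreover have "{i \<in> I. x \<in> U i} \<notin> \<S>" using that unfolding E_def by blast
    ultimately show ?thesis unfolding \<S>_def by auto
  qed
  have "E \<subseteq> (\<Union>p\<in>P. t ` (D (fst p) \<inter> D (snd p)))"
  proof
    fix x assume x: "x \<in> E"
    then have xu: "x \<in> units G" using E compact_open_units_iff by blast
    show "x \<in> (\<Union>p\<in>P. t ` (D (fst p) \<inter> D (snd p)))"
    proof (rule ccontr)
      assume n: "x \<notin> (\<Union>p\<in>P. t ` (D (fst p) \<inter> D (snd p)))"
      have "(\<Sum>i\<in>I. cmod (d i) * indicator (t ` D i) x) \<le> c"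
      proof (rule coefficient_sum_le_fibre_sum[OF t I D bound[OF xu]])
        fix i j assume "i \<in> I" "j \<in> I" "i \<noteq> j"
        then have "(i, j) \<in> P" by (simp add: P_def)
        then show "x \<notin> t ` (D i \<inter> D j)" using n by force
      qed
      then show False using above[OF x] by (simp add: U_def)
    qed
  qed
  then obtain C where C: "\<And>p. p \<in> P \<Longrightarrow> C p \<in> compact_open_bisections G \<and> C p \<subseteq> D (fst p) \<inter> D (snd p)"
    and EC: "E \<subseteq> (\<Union>p\<in>P. t ` C p)"
    using compact_cover_by_bisections[OF t E, of P "\<lambda>p. D (fst p) \<inter> D (snd p)" "\<lambda>p. D (fst p)"]
      D I unfolding P_def by (force simp: compact_open_bisection_iff)
  have P: "finite P" "card P \<le> (card I)\<^sup>2"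
  proof -
    have "P \<subseteq> I \<times> I" by (auto simp: P_def)
    then show "finite P" "card P \<le> (card I)\<^sup>2"
      using I finite_subset card_mono[of "I \<times> I" P]
      by (auto simp: card_cartesian_product power2_eq_square)
  qed
  have tC: "t ` C p \<in> compact_open_units" if "p \<in> P" for p
    using endpoint_image[OF t] C[OF that] by blast
  have "\<mu> E \<le> \<mu> (\<Union>p\<in>P. t ` C p)"
    using EC E tC P(1) by (intro mu.content_mono) auto
  also have "\<dots> \<le> (\<Sum>p\<in>P. \<mu> (t ` C p))"
    by (rule mu.content_subadditive[OF P(1) tC])
  also have "\<dots> \<le> (\<Sum>p\<in>P. \<delta>)"
  proof (rule sum_mono)
    fix p assume "p \<in> P"
    then show "\<mu> (t ` C p) \<le> \<delta>"
      using small[of "fst p" "snd p" "C p"] C[of p] by (auto simp: P_def)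
  qed
  also have "\<dots> \<le> (real (card I))\<^sup>2 * \<delta>"
    using P(2) \<open>0 \<le> \<delta>\<close> by (simp add: mult_right_mono flip: of_nat_power)
  finally have muE: "\<mu> E \<le> (real (card I))\<^sup>2 * \<delta>" .
  have "(\<Sum>i\<in>I. cmod (d i) * \<mu> (U i)) =
      (\<Sum>i\<in>I. cmod (d i) * \<mu> (U i \<inter> (X - E))) + (\<Sum>i\<in>I. cmod (d i) * \<mu> (U i \<inter> E))"
  proof -
    have "\<mu> (U i) = \<mu> (U i \<inter> (X - E)) + \<mu> (U i \<inter> E)" if "i \<in> I" for i
    proof -
      have "U i \<inter> (X - E) = U i - E" using that by (auto simp: X_def)
      then show ?thesis using mu.content_split[OF U[OF that] E] by simp
    qed
    then show ?thesis by (simp add: sum.distrib[symmetric] distrib_left)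
  qed
  also have "\<dots> \<le> c * \<mu> (X - E) + (\<Sum>i\<in>I. cmod (d i)) * \<mu> E"
  proof (rule add_mono)
    show "(\<Sum>i\<in>I. cmod (d i) * \<mu> (U i \<inter> (X - E))) \<le> c * \<mu> (X - E)"
      by (rule mu.step_function_content_le[OF I U]) (use X E below in auto)
    show "(\<Sum>i\<in>I. cmod (d i) * \<mu> (U i \<inter> E)) \<le> (\<Sum>i\<in>I. cmod (d i)) * \<mu> E"
      unfolding sum_distrib_right
      using U E by (intro sum_mono mult_left_mono mu.content_mono) auto
  qed
  also have "\<dots> \<le> c * \<mu> X + (\<Sum>i\<in>I. cmod (d i)) * ((real (card I))\<^sup>2 * \<delta>)"
    using X E \<open>0 \<le> c\<close> muE
    by (intro add_mono mult_left_mono mu.content_mono) (auto intro: sum_nonneg)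
  finally show ?thesis by (simp add: U_def X_def)
qed

end


section \<open>Convolution of indicator functions\<close>

context hausdorff_ample_groupoid
begin

definition bisection_product :: "'g set \<Rightarrow> 'g set \<Rightarrow> 'g set" where
  "bisection_product B C = {gmult G a b | a b. a \<in> B \<and> b \<in> C \<and> src G a = rng G b}"

text \<open>
  In a factorization \<open>x = a b\<close> the factor \<open>a\<close> has the range of \<open>x\<close> and \<open>b\<close> has the source of
  \<open>x\<close>. As \<open>a\<close> and \<open>b\<close> are taken from bisections, the sum has at most one nonzero term.
\<close>

lemma convolution_indicator:
  assumes B: "B \<in> compact_open_bisections G" and C: "C \<in> compact_open_bisections G"
  shows "convolution G (indicator B) (indicator C) = indicator (bisection_product B C)"
proof
  fix x
  define S where "S = {(a, b). (a, b) \<in> composable G \<and> gmult G a b = x}"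
  have arr: "B \<subseteq> arrows G" "C \<subseteq> arrows G"
    using bisection_homeomorphic(3) B C endpoint_def by blast+
  have conv: "convolution G (indicator B) (indicator C) x =
      (\<Sum>\<^sub>\<infinity>(a, b)\<in>S. indicator B a * indicator C b)"
    by (simp add: convolution_def S_def case_prod_unfold)
  show "convolution G (indicator B) (indicator C) x = indicator (bisection_product B C) x"
  proof (cases "x \<in> bisection_product B C")
    case True
    then obtain a b where ab: "a \<in> B" "b \<in> C" "src G a = rng G b" "x = gmult G a b"
      by (auto simp: bisection_product_def)
    then have comp: "(a, b) \<in> composable G" using arr by (auto simp: composable_def)
    have uniq: "a' = a \<and> b' = b" if "(a', b') \<in> S" "a' \<in> B" "b' \<in> C" for a' b'
    proof -
      have comp': "(a', b') \<in> composable G" "gmult G a' b' = x" using that(1) by (auto simp: S_def)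
      have "rng G a' = rng G a" "src G b' = src G b"
        using rng_mult[OF comp] rng_mult[OF comp'(1)] src_mult[OF comp] src_mult[OF comp'(1)]
          comp'(2) ab(4) by auto
      moreover have "inj_on (rng G) B" "inj_on (src G) C"
        using B C by (simp_all add: compact_open_bisection_iff)
      ultimately show ?thesis using ab that(2,3) by (auto dest: inj_onD)
    qed
    define h :: "'g \<times> 'g \<Rightarrow> complex" where "h = (\<lambda>(a, b). indicator B a * indicator C b)"
    have abS: "(a, b) \<in> S" using comp ab(4) by (simp add: S_def)
    have "infsum h S = infsum h {(a, b)}"
    proof (rule infsum_cong_neutral)
      show "h p = 0" if p: "p \<in> S - {(a, b)}" for p
      proof -
        have "fst p \<notin> B \<or> snd p \<notin> C"
          using p uniq[of "fst p" "snd p"] prod_eqI[of p "(a, b)"] by simp blast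
        then show ?thesis by (auto simp: h_def case_prod_unfold)
      qed
      show "h p = 0" if p: "p \<in> {(a, b)} - S" for p using p abS by simp
    qed simp
    also have "\<dots> = 1" using ab(1,2) by (simp add: h_def)
    finally show ?thesis using conv True by (simp add: h_def)
  next
    case False
    have "(\<Sum>\<^sub>\<infinity>(a, b)\<in>S. indicator B a * indicator C b) = (0 :: complex)"
    proof (rule infsum_0)
      fix p assume "p \<in> S"
      then show "(case p of (a, b) \<Rightarrow> indicator B a * indicator C b) = (0 :: complex)"
        using False by (auto simp: S_def bisection_product_def composable_def indicator_def)
    qed
    then show ?thesis using conv False by simp
  qed
qed

lemma bisection_product_range:
  assumes B: "B \<in> compact_open_bisections G"
  shows "bisection_product (rng G ` B) B = B"
proof -
  have arr: "B \<subseteq> arrows G" using bisection_homeomorphic(3)[OF B] endpoint_def by blast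
  then have "src G (rng G a) = rng G a \<and> gmult G (rng G a) a = a" if "a \<in> B" for a
    using that src_rng rng_mult_self by blast
  then show ?thesis
    unfolding bisection_product_def by (safe; metis imageI)
qed

lemma bisection_product_inverse:
  assumes B: "B \<in> compact_open_bisections G"
  shows "bisection_product (ginv G ` B) B = src G ` B"
proof -
  have arr: "B \<subseteq> arrows G" using bisection_homeomorphic(3)[OF B] endpoint_def by blast
  have inj: "inj_on (rng G) B" using B by (simp add: compact_open_bisection_iff)
  have "src G (ginv G a) = rng G a \<and> gmult G (ginv G a) a = src G a" if "a \<in> B" for a
    using that arr src_inv inv_mult by blast
  then show ?thesis
    unfolding bisection_product_def using inj by (safe; (metis inj_onD imageI)?)
qed

lemma inverse_bisection:
  assumes B: "B \<in> compact_open_bisections G"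
  shows "ginv G ` B \<in> compact_open_bisections G"
proof -
  have arr: "B \<subseteq> arrows G" using bisection_homeomorphic(3)[OF B] endpoint_def by blast
  have B': "openin (gtop G) B" "compactin (gtop G) B" "inj_on (src G) B" "inj_on (rng G) B"
    using B by (simp_all add: compact_open_bisection_iff)
  have "ginv G ` B = {x \<in> topspace (gtop G). ginv G x \<in> B}"
  proof (intro equalityI subsetI)
    fix x assume "x \<in> ginv G ` B"
    then show "x \<in> {x \<in> topspace (gtop G). ginv G x \<in> B}"
      using arr ginv_ginv inv_arrow by (auto simp: arrows_def)
  next
    fix x assume "x \<in> {x \<in> topspace (gtop G). ginv G x \<in> B}"
    then show "x \<in> ginv G ` B"
      using ginv_ginv[of x] by (auto simp: arrows_def intro: rev_image_eqI)
  qed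
  then have "openin (gtop G) (ginv G ` B)"
    using continuous_inv B'(1) by (simp add: continuous_map_def)
  moreover have "compactin (gtop G) (ginv G ` B)"
    by (rule image_compactin[OF B'(2) continuous_inv])
  moreover have "inj_on (src G) (ginv G ` B)"
  proof (rule inj_onI, safe)
    fix a b assume "a \<in> B" "b \<in> B" "src G (ginv G a) = src G (ginv G b)"
    then have "a = b" using arr src_inv inj_onD[OF B'(4)] by (metis subsetD)
    then show "ginv G a = ginv G b" by simp
  qed
  moreover have "inj_on (rng G) (ginv G ` B)"
  proof (rule inj_onI, safe)
    fix a b assume "a \<in> B" "b \<in> B" "rng G (ginv G a) = rng G (ginv G b)"
    then have "a = b" using arr rng_inv inj_onD[OF B'(3)] by (metis subsetD)
    then show "ginv G a = ginv G b" by simp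
  qed
  ultimately show ?thesis by (simp add: compact_open_bisection_iff)
qed

lemma involution_indicator:
  assumes B: "B \<in> compact_open_bisections G"
  shows "involution G (indicator B) = indicator (ginv G ` B)"
proof
  fix x
  have arr: "B \<subseteq> arrows G" using bisection_homeomorphic(3)[OF B] endpoint_def by blast
  have "x \<in> ginv G ` B \<longleftrightarrow> x \<in> arrows G \<and> ginv G x \<in> B"
    using arr ginv_ginv inv_arrow by (metis (no_types, lifting) imageE imageI subsetD)
  then show "involution G (indicator B) x = indicator (ginv G ` B) x"
    by (simp add: involution_def indicator_def)
qed

lemma inverse_units: "U \<subseteq> units G \<Longrightarrow> ginv G ` U = U"
  using unit_simps(4) by (force simp: subset_iff)

lemma scaled_indicator_in_steinberg_algebra:
  assumes "B \<in> compact_open_bisections G"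
  shows "(\<lambda>x. c * indicator B x) \<in> steinberg_algebra G"
proof -
  have "c * indicator B x = (\<Sum>X\<in>{B}. c * indicator X x)" for x
    by (subst sum.insert) simp_all
  then show ?thesis
    unfolding steinberg_algebra_def using assms
    by (intro CollectI exI[of _ "{B}"] exI[of _ "\<lambda>_. c"] conjI ext) simp_all
qed

lemma indicator_in_steinberg_algebra:
  "B \<in> compact_open_bisections G \<Longrightarrow> indicator B \<in> steinberg_algebra G"
  using scaled_indicator_in_steinberg_algebra[of B 1] by simp

lemma steinberg_algebra_add:
  assumes "f \<in> steinberg_algebra G" "g \<in> steinberg_algebra G"
  shows "(\<lambda>x. f x + g x) \<in> steinberg_algebra G"
proof -
  obtain F c where F: "finite F" "F \<subseteq> compact_open_bisections G"
    "f = (\<lambda>x. \<Sum>B\<in>F. c B * indicator B x)"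
    using assms(1) by (auto simp: steinberg_algebra_def)
  obtain F' c' where F': "finite F'" "F' \<subseteq> compact_open_bisections G"
    "g = (\<lambda>x. \<Sum>B\<in>F'. c' B * indicator B x)"
    using assms(2) by (auto simp: steinberg_algebra_def)
  define e where "e B = (if B \<in> F then c B else 0) + (if B \<in> F' then c' B else 0)" for B
  have "f x + g x = (\<Sum>B\<in>F \<union> F'. e B * indicator B x)" for x
  proof -
    have "(\<Sum>B\<in>F. c B * indicator B x) =
        (\<Sum>B\<in>F \<union> F'. (if B \<in> F then c B else 0) * indicator B x)"
      using F(1) F'(1) by (intro sum.mono_neutral_cong_left) auto
    moreover have "(\<Sum>B\<in>F'. c' B * indicator B x) =
        (\<Sum>B\<in>F \<union> F'. (if B \<in> F' then c' B else 0) * indicator B x)"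
      using F(1) F'(1) by (intro sum.mono_neutral_cong_left) auto
    ultimately show ?thesis by (simp only: F(3) F'(3) e_def distrib_right sum.distrib)
  qed
  then show ?thesis
    unfolding steinberg_algebra_def using F F'
    by (intro CollectI exI[of _ "F \<union> F'"] exI[of _ e]) auto
qed

lemma step_function_in_steinberg_algebra:
  "(\<And>p. p \<in> set L \<Longrightarrow> snd p \<in> compact_open_bisections G) \<Longrightarrow> step_function L \<in> steinberg_algebra G"
proof (induction L)
  case Nil
  have "step_function [] = (\<lambda>x. 0 * indicator {} x)" by (simp add: fun_eq_iff)
  then show ?case using scaled_indicator_in_steinberg_algebra[OF empty_bisection, of 0] by simp
next
  case (Cons p L)
  have "step_function (p # L) = (\<lambda>x. fst p * indicator (snd p) x + step_function L x)"
    by (cases p) (simp add: fun_eq_iff)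
  then show ?case
    using steinberg_algebra_add[OF scaled_indicator_in_steinberg_algebra] Cons by simp
qed

lemma step_function_nth:
  "step_function L x = (\<Sum>i<length L. fst (L ! i) * indicator (snd (L ! i)) x)"
  by (simp add: step_function_def sum_list_sum_nth case_prod_unfold atLeast0LessThan)

lemma fibre_sum_le_I_norm:
  assumes t: "endpoint t" and x: "x \<in> units G" and fin: "finite \<Gamma>"
    and \<Gamma>: "\<Gamma> \<subseteq> {a \<in> arrows G. t a = x}"
  shows "ennreal (\<Sum>a\<in>\<Gamma>. cmod (f a)) \<le> I_norm G f"
proof -
  let ?s = "\<Sum>\<^sub>\<infinity>a\<in>{a \<in> arrows G. src G a = x}. ennreal (cmod (f a))"
  let ?r = "\<Sum>\<^sub>\<infinity>a\<in>{a \<in> arrows G. rng G a = x}. ennreal (cmod (f a))"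
  have "ennreal (\<Sum>a\<in>\<Gamma>. cmod (f a)) = (\<Sum>\<^sub>\<infinity>a\<in>\<Gamma>. ennreal (cmod (f a)))"
    using fin by simp
  also have "\<dots> \<le> (\<Sum>\<^sub>\<infinity>a\<in>{a \<in> arrows G. t a = x}. ennreal (cmod (f a)))"
    by (rule infsum_mono_neutral) (use \<Gamma> in \<open>auto intro: nonneg_summable_on_complete\<close>)
  also have "\<dots> \<le> max ?s ?r" using t by (auto simp: endpoint_def)
  also have "\<dots> \<le> I_norm G f" unfolding I_norm_def by (rule SUP_upper[OF x])
  finally show ?thesis .
qed

end


section \<open>Representations\<close>

locale steinberg_representation = hausdorff_ample_groupoid G
  for G :: "'g groupoid_structure" +
  fixes \<pi> :: "('g \<Rightarrow> complex) \<Rightarrow> ('h::complex_hilbert_space \<Rightarrow>\<^sub>L 'h)"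
  assumes star_hom: "steinberg_star_hom G \<pi>"
begin

lemma rep_add:
  "f \<in> steinberg_algebra G \<Longrightarrow> g \<in> steinberg_algebra G \<Longrightarrow> \<pi> (\<lambda>x. f x + g x) = \<pi> f + \<pi> g"
  using star_hom unfolding steinberg_star_hom_def by blast

lemma rep_scale: "f \<in> steinberg_algebra G \<Longrightarrow> \<pi> (\<lambda>x. c * f x) \<xi> = c *\<^sub>C \<pi> f \<xi>"
  using star_hom unfolding steinberg_star_hom_def by blast

lemma rep_indicator_mult:
  assumes "B \<in> compact_open_bisections G" "C \<in> compact_open_bisections G"
  shows "\<pi> (indicator B) (\<pi> (indicator C) \<xi>) = \<pi> (indicator (bisection_product B C)) \<xi>"
proof -
  have "\<pi> (convolution G (indicator B) (indicator C)) = \<pi> (indicator B) o\<^sub>L \<pi> (indicator C)"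
    using star_hom indicator_in_steinberg_algebra assms unfolding steinberg_star_hom_def by blast
  then show ?thesis using convolution_indicator[OF assms] by simp
qed

lemma rep_indicator_adjoint:
  assumes "B \<in> compact_open_bisections G"
  shows "cinner (\<pi> (indicator B) \<xi>) \<eta> = cinner \<xi> (\<pi> (indicator (ginv G ` B)) \<eta>)"
proof -
  have "is_adjoint (\<pi> (involution G (indicator B))) (\<pi> (indicator B))"
    using star_hom indicator_in_steinberg_algebra assms unfolding steinberg_star_hom_def by blast
  then show ?thesis using involution_indicator[OF assms] by (simp add: is_adjoint_def)
qed

text \<open>
  Compact open sets of units act as commuting projections. This is the scalar spectral measure of
  \<open>\<xi>\<close> for them, the squared norm of the projected vector.
\<close>

definition spectral_content :: "'h \<Rightarrow> 'g set \<Rightarrow> real" where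
  "spectral_content \<xi> U = (norm (\<pi> (indicator U) \<xi>))\<^sup>2"

text \<open>
  Both sides are the inner product of \<open>\<xi>\<close> with the image of \<open>\<xi>\<close> under the operator of the set
  \<open>B\<^sup>-\<^sup>1 B\<close>, which consists of the sources of the arrows in \<open>B\<close>.
\<close>

lemma norm_rep_indicator:
  assumes "B \<in> compact_open_bisections G"
  shows "complex_of_real ((norm (\<pi> (indicator B) \<xi>))\<^sup>2) = cinner \<xi> (\<pi> (indicator (src G ` B)) \<xi>)"
  unfolding cinner_self[symmetric] rep_indicator_adjoint[OF assms]
    rep_indicator_mult[OF inverse_bisection[OF assms] assms] bisection_product_inverse[OF assms] ..

lemma spectral_content_eq:
  assumes "U \<in> compact_open_units"
  shows "complex_of_real (spectral_content \<xi> U) = cinner \<xi> (\<pi> (indicator U) \<xi>)"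
proof -
  have U: "U \<in> compact_open_bisections G" "U \<subseteq> units G"
    using assms by (auto simp: compact_open_units_def)
  have "src G ` U = U" using U(2) unit_simps(2) by (force simp: subset_iff)
  then show ?thesis using norm_rep_indicator[OF U(1)] by (simp add: spectral_content_def)
qed

lemma norm_rep_bisection:
  assumes "B \<in> compact_open_bisections G"
  shows "(norm (\<pi> (indicator B) \<xi>))\<^sup>2 = spectral_content \<xi> (src G ` B)"
proof -
  have "src G ` B \<in> compact_open_units" using assms by (simp add: endpoint_image endpoint_def)
  then have "complex_of_real ((norm (\<pi> (indicator B) \<xi>))\<^sup>2) =
      complex_of_real (spectral_content \<xi> (src G ` B))"
    using norm_rep_indicator[OF assms, of \<xi>] spectral_content_eq[of "src G ` B" \<xi>] by simp
  then show ?thesis using of_real_eq_iff by blast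
qed

text \<open>The squared norm of a projected vector is its inner product with \<open>\<xi>\<close>.\<close>

lemma spectral_content_le:
  assumes "U \<in> compact_open_units"
  shows "spectral_content \<xi> U \<le> (norm \<xi>)\<^sup>2"
proof -
  have "2 * cmod (complex_of_real (spectral_content \<xi> U)) \<le> (norm \<xi>)\<^sup>2 + spectral_content \<xi> U"
    unfolding spectral_content_eq[OF assms] by (simp only: spectral_content_def cmod_cinner_le)
  moreover have "0 \<le> spectral_content \<xi> U" by (simp add: spectral_content_def)
  ultimately show ?thesis by (simp only: norm_of_real)
qed

lemma finite_content_spectral:
  "finite_content (units G) compact_open_units (spectral_content \<xi>)"
proof
  fix U V assume UV: "U \<in> compact_open_units" "V \<in> compact_open_units" "U \<inter> V = {}"
  have "indicator (U \<union> V) = (\<lambda>x. indicator U x + indicator V x :: complex)"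
    using UV(3) by (auto simp: indicator_def fun_eq_iff)
  then have "\<pi> (indicator (U \<union> V)) = \<pi> (indicator U) + \<pi> (indicator V)"
    using rep_add[of "indicator U" "indicator V"] UV indicator_in_steinberg_algebra
    by (simp add: compact_open_units_def)
  then have "complex_of_real (spectral_content \<xi> (U \<union> V)) =
      complex_of_real (spectral_content \<xi> U + spectral_content \<xi> V)"
    using UV by (simp add: spectral_content_eq unit_ring.Un blinfun.add_left cinner_add_right)
  then show "spectral_content \<xi> (U \<union> V) = spectral_content \<xi> U + spectral_content \<xi> V"
    using of_real_eq_iff by blast
qed (simp add: spectral_content_def)

text \<open>
  The operator of \<open>B\<close> is a partial isometry whose initial and final projections belong to the
  source and the range of \<open>B\<close>.
\<close>

lemma cmod_cinner_rep_bisection_le: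
  assumes B: "B \<in> compact_open_bisections G"
  shows "2 * cmod (cinner (\<pi> (indicator B) \<xi>) \<eta>) \<le>
    spectral_content \<xi> (src G ` B) + spectral_content \<eta> (rng G ` B)"
proof -
  have "rng G ` B \<in> compact_open_units" using B by (simp add: endpoint_image endpoint_def)
  then have r: "rng G ` B \<in> compact_open_bisections G" "ginv G ` (rng G ` B) = rng G ` B"
    using inverse_units by (auto simp only: compact_open_units_def mem_Collect_eq)
  have "cinner (\<pi> (indicator B) \<xi>) \<eta> = cinner (\<pi> (indicator (rng G ` B)) (\<pi> (indicator B) \<xi>)) \<eta>"
    using rep_indicator_mult[OF r(1) B] bisection_product_range[OF B] by simp
  also have "\<dots> = cinner (\<pi> (indicator B) \<xi>) (\<pi> (indicator (rng G ` B)) \<eta>)"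
    using rep_indicator_adjoint[OF r(1)] r(2) by simp
  finally show ?thesis
    using cmod_cinner_le[of "\<pi> (indicator B) \<xi>" "\<pi> (indicator (rng G ` B)) \<eta>"]
    by (simp add: norm_rep_bisection[OF B] spectral_content_def[of \<eta>])
qed

lemma cinner_rep_step_function:
  "(\<And>p. p \<in> set L \<Longrightarrow> snd p \<in> compact_open_bisections G) \<Longrightarrow>
    cinner (\<pi> (step_function L) \<xi>) \<eta> = (\<Sum>p\<leftarrow>L. fst p * cinner (\<pi> (indicator (snd p)) \<xi>) \<eta>)"
proof (induction L)
  case Nil
  have "step_function [] = (\<lambda>x. 0 * indicator {} x)" by (simp add: fun_eq_iff)
  then show ?case
    using rep_scale[OF indicator_in_steinberg_algebra[OF empty_bisection], of 0 \<xi>]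
    by (simp add: scaleC_zero_left cinner_zero_left)
next
  case (Cons p L)
  have p: "snd p \<in> compact_open_bisections G" using Cons.prems by simp
  have "step_function (p # L) = (\<lambda>x. fst p * indicator (snd p) x + step_function L x)"
    by (cases p) (simp add: fun_eq_iff)
  then have "\<pi> (step_function (p # L)) = \<pi> (\<lambda>x. fst p * indicator (snd p) x) + \<pi> (step_function L)"
    using rep_add[OF scaled_indicator_in_steinberg_algebra[OF p] step_function_in_steinberg_algebra]
      Cons.prems by simp
  then show ?case
    using Cons rep_scale[OF indicator_in_steinberg_algebra[OF p]]
    by (simp add: blinfun.add_left cinner_add_left cinner_scaleC_left)
qed

lemma bisection_content_spectral:
  "bisection_content (\<lambda>E. spectral_content \<xi> (src G ` E) + spectral_content \<eta> (rng G ` E))"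
  unfolding bisection_content_def
proof (intro conjI ballI impI)
  fix E F assume EF: "E \<in> compact_open_bisections G" "F \<in> compact_open_bisections G"
    "E \<union> F \<in> compact_open_bisections G" "E \<inter> F = {}"
  have "spectral_content \<zeta> (t ` (E \<union> F)) = spectral_content \<zeta> (t ` E) + spectral_content \<zeta> (t ` F)"
    if t: "endpoint t" for t \<zeta>
  proof -
    have "t ` E \<inter> t ` F = t ` (E \<inter> F)"
      using inj_on_image_Int[OF bisection_inj_on[OF EF(3) t], of E F] by simp
    then show ?thesis
      using finite_content.content_Un[OF finite_content_spectral, of "t ` E" "t ` F" \<zeta>]
        endpoint_image[OF t] EF by (simp add: image_Un)
  qed
  from this[of "src G" \<xi>] this[of "rng G" \<eta>]
  show "spectral_content \<xi> (src G ` (E \<union> F)) + spectral_content \<eta> (rng G ` (E \<union> F)) =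
    (spectral_content \<xi> (src G ` E) + spectral_content \<eta> (rng G ` E)) +
    (spectral_content \<xi> (src G ` F) + spectral_content \<eta> (rng G ` F))"
    by (simp add: endpoint_def)
qed (simp add: spectral_content_def)

text \<open>
  Schur's test. The matrix coefficient of each piece is split between its source and its range,
  and the two resulting sums are integrals of step functions that are bounded by fibre sums of \<open>f\<close>
  away from the overlaps of the pieces.
  The number of pieces and their coefficients stay bounded as \<open>\<delta>\<close> tends to \<open>0\<close>, so the
  overlaps contribute nothing in the limit.
\<close>

lemma cmod_cinner_rep_le:
  assumes f: "f \<in> steinberg_algebra G" and I: "I_norm G f \<le> ennreal c" and c: "0 \<le> c"
  shows "2 * cmod (cinner (\<pi> f \<xi>) \<eta>) \<le> c * ((norm \<xi>)\<^sup>2 + (norm \<eta>)\<^sup>2)"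
proof -
  let ?s = "\<lambda>E. spectral_content \<xi> (src G ` E)"
  let ?r = "\<lambda>E. spectral_content \<eta> (rng G ` E)"
  obtain N K where K: "0 \<le> K"
    and dec: "\<And>\<delta>. \<delta> > 0 \<Longrightarrow> \<exists>L. almost_disjoint_pieces (\<lambda>E. ?s E + ?r E) \<delta> K L \<and>
        length L \<le> N \<and> f = step_function L"
    using almost_disjoint_decomposition[OF bisection_content_spectral f] by blast
  define A where "A = 2 * (real N * K * (real N)\<^sup>2)"
  have A: "0 \<le> A" using K by (simp add: A_def)
  have main: "2 * cmod (cinner (\<pi> f \<xi>) \<eta>) \<le> c * ((norm \<xi>)\<^sup>2 + (norm \<eta>)\<^sup>2) + A * \<delta>"
    if \<delta>: "\<delta> > 0" for \<delta>
  proof -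
    obtain L where L: "almost_disjoint_pieces (\<lambda>E. ?s E + ?r E) \<delta> K L" "length L \<le> N"
      "f = step_function L" using dec[OF \<delta>] by blast
    define J where "J = {..<length L}"
    define d where "d i = fst (L ! i)" for i
    define D where "D i = snd (L ! i)" for i
    have J: "finite J" "card J \<le> N" using L(2) by (simp_all add: J_def)
    have LD: "\<And>p. p \<in> set L \<Longrightarrow> snd p \<in> compact_open_bisections G \<and> cmod (fst p) \<le> K"
      and sorted: "sorted_wrt (\<lambda>p q. almost_disjoint (\<lambda>E. ?s E + ?r E) \<delta> (snd p) (snd q)) L"
      using L(1) by (auto simp: almost_disjoint_pieces_def)
    have D: "D i \<in> compact_open_bisections G" and dK: "cmod (d i) \<le> K" if "i \<in> J" for i
      using LD[of "L ! i"] that by (auto simp: J_def D_def d_def)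
    have f_eq: "f a = (\<Sum>i\<in>J. d i * indicator (D i) a)" for a
      by (simp add: L(3) step_function_nth J_def d_def D_def)
    have small: "?s E + ?r E \<le> \<delta>"
      if "i \<in> J" "j \<in> J" "i \<noteq> j" "E \<in> compact_open_bisections G" "E \<subseteq> D i \<inter> D j" for i j E
    proof -
      have lt: "?s E + ?r E \<le> \<delta>" if "i < j" "j \<in> J" "E \<subseteq> D i \<inter> D j" for i j
        using sorted that \<open>E \<in> compact_open_bisections G\<close>
        unfolding sorted_wrt_iff_nth_less almost_disjoint_def J_def D_def by simp
      show ?thesis using lt[of i j] lt[of j i] that by (cases "i < j") (auto simp: Int_commute)
    qed
    have fibre: "(\<Sum>a\<in>\<Gamma>. cmod (\<Sum>i\<in>J. d i * indicator (D i) a)) \<le> c"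
      if "endpoint t" "x \<in> units G" "finite \<Gamma>" "\<Gamma> \<subseteq> {a \<in> arrows G. t a = x}" for t x \<Gamma>
      using order_trans[OF fibre_sum_le_I_norm[OF that, of f] I] c by (simp add: f_eq[symmetric])
    have total: "(\<Sum>i\<in>J. cmod (d i)) * ((real (card J))\<^sup>2 * \<delta>) \<le> real N * K * ((real N)\<^sup>2 * \<delta>)"
    proof (rule mult_mono)
      have "(\<Sum>i\<in>J. cmod (d i)) \<le> real (card J) * K"
        using sum_bounded_above[of J "\<lambda>i. cmod (d i)" K] dK by simp
      also have "\<dots> \<le> real N * K" using J(2) K by (intro mult_right_mono) auto
      finally show "(\<Sum>i\<in>J. cmod (d i)) \<le> real N * K" .
      show "(real (card J))\<^sup>2 * \<delta> \<le> (real N)\<^sup>2 * \<delta>"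
        using J(2) \<delta> by (intro mult_right_mono power_mono) auto
    qed (use K \<delta> in auto)
    have one_side: "(\<Sum>i\<in>J. cmod (d i) * spectral_content \<zeta> (t ` D i)) \<le>
        c * (norm \<zeta>)\<^sup>2 + real N * K * ((real N)\<^sup>2 * \<delta>)"
      if t: "endpoint t" and le: "\<And>E. spectral_content \<zeta> (t ` E) \<le> ?s E + ?r E" for t \<zeta>
    proof -
      have "(\<Sum>i\<in>J. cmod (d i) * spectral_content \<zeta> (t ` D i)) \<le>
          c * spectral_content \<zeta> (\<Union>i\<in>J. t ` D i) + (\<Sum>i\<in>J. cmod (d i)) * ((real (card J))\<^sup>2 * \<delta>)"
        by (rule fibre_sum_content_le[OF finite_content_spectral t J(1) D fibre[OF t]
              order_trans[OF le small] c]) (use \<delta> in auto)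
      moreover have "c * spectral_content \<zeta> (\<Union>i\<in>J. t ` D i) \<le> c * (norm \<zeta>)\<^sup>2"
        using c J(1) endpoint_image[OF t D]
        by (intro mult_left_mono spectral_content_le unit_ring.finite_UN) auto
      ultimately show ?thesis using total by linarith
    qed
    have "cinner (\<pi> f \<xi>) \<eta> = (\<Sum>i\<in>J. d i * cinner (\<pi> (indicator (D i)) \<xi>) \<eta>)"
      unfolding L(3) using cinner_rep_step_function[of L \<xi> \<eta>] LD
      by (simp add: sum_list_sum_nth J_def d_def D_def atLeast0LessThan)
    then have "2 * cmod (cinner (\<pi> f \<xi>) \<eta>) \<le>
        (\<Sum>i\<in>J. cmod (d i) * (2 * cmod (cinner (\<pi> (indicator (D i)) \<xi>) \<eta>)))"
      using norm_sum[of "\<lambda>i. d i * cinner (\<pi> (indicator (D i)) \<xi>) \<eta>" J]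
      by (simp add: norm_mult sum_distrib_left mult.left_commute flip: sum_distrib_left)
    also have "\<dots> \<le> (\<Sum>i\<in>J. cmod (d i) * (?s (D i) + ?r (D i)))"
      by (intro sum_mono mult_left_mono cmod_cinner_rep_bisection_le D) auto
    also have "\<dots> = (\<Sum>i\<in>J. cmod (d i) * ?s (D i)) + (\<Sum>i\<in>J. cmod (d i) * ?r (D i))"
      by (simp add: distrib_left sum.distrib)
    also have "\<dots> \<le> (c * (norm \<xi>)\<^sup>2 + real N * K * ((real N)\<^sup>2 * \<delta>)) +
        (c * (norm \<eta>)\<^sup>2 + real N * K * ((real N)\<^sup>2 * \<delta>))"
      by (intro add_mono one_side) (simp_all add: endpoint_def spectral_content_def)
    also have "\<dots> = c * ((norm \<xi>)\<^sup>2 + (norm \<eta>)\<^sup>2) + A * \<delta>"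
      by (simp add: A_def algebra_simps)
    finally show ?thesis .
  qed
  show ?thesis
  proof (rule field_le_epsilon)
    fix e :: real assume e: "e > 0"
    have "A * (e / (A + 1)) \<le> e" using A e by (simp add: field_simps)
    then show "2 * cmod (cinner (\<pi> f \<xi>) \<eta>) \<le> c * ((norm \<xi>)\<^sup>2 + (norm \<eta>)\<^sup>2) + e"
      using main[of "e / (A + 1)"] A e by simp
  qed
qed

text \<open>The bound on matrix coefficients is tested on vectors \<open>\<xi>\<close> and \<open>\<eta>\<close> of equal norm.\<close>

lemma norm_rep_le:
  assumes f: "f \<in> steinberg_algebra G" and I: "I_norm G f \<le> ennreal c" and c: "0 \<le> c"
  shows "norm (\<pi> f) \<le> c"
proof (rule norm_blinfun_bound[OF c])
  fix \<xi>
  show "norm (\<pi> f \<xi>) \<le> c * norm \<xi>"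
  proof (cases "\<pi> f \<xi> = 0")
    case False
    then have pos: "norm \<xi> > 0" "norm (\<pi> f \<xi>) > 0" by (auto simp: blinfun.zero_right)
    \<comment> \<open>\<open>\<eta>\<close> points in the direction of the image of \<open>\<xi>\<close> and has the norm of \<open>\<xi>\<close>, so that both squares
      on the right of the estimate for matrix coefficients agree\<close>
    define r where "r = norm \<xi> / norm (\<pi> f \<xi>)"
    define \<eta> where "\<eta> = complex_of_real r *\<^sub>C \<pi> f \<xi>"
    have r: "r > 0" using pos by (simp add: r_def)
    have \<eta>: "norm \<eta> = norm \<xi>" unfolding \<eta>_def scaleC_of_real using pos by (simp add: r_def)
    have "cinner (\<pi> f \<xi>) \<eta> = complex_of_real (r * (norm (\<pi> f \<xi>))\<^sup>2)"
      by (simp add: \<eta>_def cinner_scaleC_right cinner_self)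
    then have "cmod (cinner (\<pi> f \<xi>) \<eta>) = r * (norm (\<pi> f \<xi>))\<^sup>2"
      using r by (simp only: norm_of_real) simp
    also have "\<dots> = norm \<xi> * norm (\<pi> f \<xi>)" using pos by (simp add: r_def power2_eq_square)
    finally have "2 * (norm \<xi> * norm (\<pi> f \<xi>)) \<le> c * ((norm \<xi>)\<^sup>2 + (norm \<xi>)\<^sup>2)"
      using cmod_cinner_rep_le[OF f I c, of \<xi> \<eta>] by (simp only: \<eta>)
    then have "norm \<xi> * norm (\<pi> f \<xi>) \<le> norm \<xi> * (c * norm \<xi>)"
      by (simp add: power2_eq_square algebra_simps)
    then show ?thesis using pos(1) by simp
  qed (use c in simp)
qed

end

theorem corollary5p6:
  fixes G :: "'g groupoid_structure"
    and \<pi> :: "('g \<Rightarrow> complex) \<Rightarrow> ('h::complex_hilbert_space \<Rightarrow>\<^sub>L 'h)"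
  assumes "ample_groupoid G"
    and "second_countable (gtop G)"
    and "Hausdorff_space (unit_top G)"
    and "steinberg_star_hom G \<pi>"
  shows "\<exists>M::real. M \<ge> 0 \<and>
           (\<forall>f \<in> steinberg_algebra G. ennreal (norm (\<pi> f)) \<le> ennreal M * I_norm G f)"
proof (intro exI[of _ 1] conjI ballI)
  \<comment> \<open>the constant is \<open>1\<close>, and an infinite \<open>I\<close>-norm bounds every operator norm\<close>
  fix f assume f: "f \<in> steinberg_algebra G"
  interpret ample_groupoid G by (rule assms(1))
  interpret steinberg_representation G \<pi> by unfold_locales (rule assms)+
  show "ennreal (norm (\<pi> f)) \<le> ennreal 1 * I_norm G f"
  proof (cases "I_norm G f")
    case (real c)
    then show ?thesis using norm_rep_le[OF f, of c] by (simp add: ennreal_leI)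
  qed simp
qed simp

end
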